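(* Let $\mathbb X$ be a developable complex of groups over a connected scwol $X$ and let $\sigma_0\in VX$. Define $V\tilde X_{\sigma_0}:=\{[\![p]\!]:p\in\mathcal P_{\sigma_0}(\mathbb X)\}$, $E\tilde X_{\sigma_0}:=\{([\![p]\!],a,[\![p\star(1,a,1)]\!]): p\in\mathcal P_{\sigma_0}(\mathbb X),\ a\in EX,\ i(a)=t(p)\}$, and let $i,t:E\tilde X_{\sigma_0}\to V\tilde X_{\sigma_0}$ be the projections to the first and third component. Then the assignment $$([\![p\star(1,b,1)]\!],a,[\![p\star(1,b,1,a,1)]\!])\cdot([\![p]\!],b,[\![p\star(1,b,1)]\!]):=([\![p]\!],ab,[\![p\star(1,ab,1)]\!])$$ is a well-defined map $E^2\tilde X_{\sigma_0}\to E\tilde X_{\sigma_0}$, and $\tilde X_{\sigma_0}:=(V\tilde X_{\sigma_0},E\tilde X_{\sigma_0},i,t,\cdot)$ is a connected scwol. Furthermore, the maps $$([q],[\![p]\!])\mapsto[\![q\star p]\!],\qquad \bigl([q],([\![p]\!],a,[\![p\star(1,a,1)]\!])\bigr)\mapsto([\![q\star p]\!],a,[\![q\star p\star(1,a,1)]\!])$$ for $[q]\in\pi_1(\mathbb X,\sigma_0)$ define an action of the group $\pi_1(\mathbb X,\sigma_0)$ on the scwol $\tilde X_{\sigma_0}$.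
   Context: Scwols. A scwol $X$ consists of sets $VX$ (vertices), $EX$ (edges), maps $i,t:EX\to VX$ and a composition $E^2X:=\{(a,b)\in EX\times EX: i(a)=t(b)\}\to EX$, $(a,b)\mapsto ab$, with $i(ab)=i(b)$, $t(ab)=t(a)$; $(ab)c=a(bc)$ whenever $i(a)=t(b)$, $i(b)=t(c)$; and $i(a)\neq t(a)$ for all $a\in EX$. $E^3X$ is the set of triples of edges $(a,b,c)$ with $i(a)=t(b)$, $i(b)=t(c)$. A morphism of scwols $f:X\to Y$ maps vertices to vertices and edges to edges, commutes with $i,t$, satisfies $f(ab)=f(a)f(b)$ for $(a,b)\in E^2X$, and for each $\sigma\in VX$ restricts to a bijection $\{a\in EX:i(a)=\sigma\}\to\{a'\in EY:i(a')=f(\sigma)\}$. $\mathrm{Aut}(X)$ is the group of bijective morphisms $X\to X$. An action of a group $H$ on $X$ is a homomorphism $H\to\mathrm{Aut}(X)$ such that $h\cdot i(a)\ne t(a)$ for all $h\in H,a\in EX$, and $h\cdot i(a)=i(a)$ implies $h\cdot a=a$. Complexes of groups. A complex of groups $\mathbb X$ over $X$ is a tuple $((G_\sigma)_{\sigma\in VX},(\psi_a)_{a\in EX},(g_{a,b})_{(a,b)\in E^2X})$ with groups $G_\sigma$, injective homomorphisms $\psi_a:G_{i(a)}\to G_{t(a)}$ and elements $g_{a,b}\in G_{t(a)}$ such that $c_{g_{a,b}}\circ\psi_{ab}=\psi_a\circ\psi_b$ on $E^2X$ and $\psi_a(g_{b,c})g_{a,bc}=g_{a,b}g_{ab,c}$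 on $E^3X$, where $c_h(g)=hgh^{-1}$. Paths. Oriented edges are the $a\in EX$ and formal inverses $a^{-1}$, with $i(a^{-1})=t(a)$, $t(a^{-1})=i(a)$, $(a^{-1})^{-1}=a$. A path in $X$ is a finite sequence of oriented edges $(e_1,\dots,e_k)$ with $t(e_j)=i(e_{j+1})$; $X$ is connected if any two vertices are joined by a finite path. An $\mathbb X$-path is a tuple $p=(g_0,e_1,g_1,\dots,e_k,g_k)$ with $(e_1,\dots,e_k)$ a path, $g_0\in G_{i(e_1)}$, $g_j\in G_{t(e_j)}$; $i(p)=i(e_1)$, $t(p)=t(e_k)$ (for length $0$: $p=(g)$ with $g\in G_\sigma$, at a vertex $\sigma$). Concatenation $p\star q$ (when $t(p)=i(q)$) multiplies the last group element of $p$ with the first of $q$. $\mathcal P_{\sigma_0}(\mathbb X)$ denotes the set of $\mathbb X$-paths starting at $\sigma_0$. Homotopy $\sim$ of $\mathbb X$-paths is the equivalence relation generated by the following replacements of subpaths: $(kg,a,h)\to(k,a,\psi_a(g)h)$; $(g,a^{-1},hk)\to(g\psi_a(h),a^{-1},k)$; $(g,a,\psi_a(h),a^{-1},k)\to(ghk)$; $(g,b^{-1},h,b,k)\to(g\psi_b(h)k)$; $(g,b,1,a,k)\to(g,ab,g_{a,b}^{-1}k)$ and $(g,a^{-1},1,b^{-1},k)\to(gg_{a,b},(ab)^{-1},k)$ for $(a,b)\in E^2X$. $[p]$ is the homotopy class. $\pi_1(\mathbb X,\sigma_0)$ is the group of homotopy classes of $\mathbb X$-paths from $\sigma_0$ to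 $\sigma_0$ with $[p][q]=[p\star q]$. $\mathbb X$ is developable if it arises (up to isomorphism) from an action of a group on a scwol; equivalently (and this may be taken as the definition), for every $\sigma\in VX$ the homomorphism $G_\sigma\to\pi_1(\mathbb X,\sigma)$, $g\mapsto[(g)]$, is injective. For $p,q\in\mathcal P_{\sigma_0}(\mathbb X)$ put $p\equiv q$ iff $[q]=[p\star(g)]$ for some $g\in G_{t(p)}$; $[\![p]\!]$ is the $\equiv$-class of $p$. *)

theory Defs
  imports "HOL-Algebra.Bij"
begin

section \<open>Small categories without loops\<close>

record ('v, 'e) scwol_data =
  vertices :: "'v set"
  edges :: "'e set"
  ini :: "'e \<Rightarrow> 'v"
  ter :: "'e \<Rightarrow> 'v"
  ecomp :: "'e \<Rightarrow> 'e \<Rightarrow> 'e"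

definition edge_pairs :: "('v, 'e) scwol_data \<Rightarrow> ('e \<times> 'e) set" where
  "edge_pairs X = {(a, b). a \<in> edges X \<and> b \<in> edges X \<and> ini X a = ter X b}"

definition edge_triples :: "('v, 'e) scwol_data \<Rightarrow> ('e \<times> 'e \<times> 'e) set" where
  "edge_triples X = {(a, b, c). (a, b) \<in> edge_pairs X \<and> (b, c) \<in> edge_pairs X}"

locale scwol =
  fixes X :: "('v, 'e) scwol_data"
  assumes ini_closed: "a \<in> edges X \<Longrightarrow> ini X a \<in> vertices X"
    and ter_closed: "a \<in> edges X \<Longrightarrow> ter X a \<in> vertices X"
    and ecomp_closed: "(a, b) \<in> edge_pairs X \<Longrightarrow> ecomp X a b \<in> edges X"
    and ini_ecomp: "(a, b) \<in> edge_pairs X \<Longrightarrow> ini X (ecomp X a b) = ini X b"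
    and ter_ecomp: "(a, b) \<in> edge_pairs X \<Longrightarrow> ter X (ecomp X a b) = ter X a"
    and ecomp_assoc: "(a, b, c) \<in> edge_triples X \<Longrightarrow>
      ecomp X (ecomp X a b) c = ecomp X a (ecomp X b c)"
    and no_loops: "a \<in> edges X \<Longrightarrow> ini X a \<noteq> ter X a"

definition scwol_morphism ::
    "('v, 'e) scwol_data \<Rightarrow> ('w, 'f) scwol_data \<Rightarrow> ('v \<Rightarrow> 'w) \<Rightarrow> ('e \<Rightarrow> 'f) \<Rightarrow> bool" where
  "scwol_morphism X Y f g \<longleftrightarrow>
     f \<in> vertices X \<rightarrow> vertices Y \<and> g \<in> edges X \<rightarrow> edges Y \<and>
     (\<forall>a\<in>edges X. ini Y (g a) = f (ini X a) \<and> ter Y (g a) = f (ter X a)) \<and>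
     (\<forall>(a, b)\<in>edge_pairs X. g (ecomp X a b) = ecomp Y (g a) (g b)) \<and>
     (\<forall>\<sigma>\<in>vertices X. bij_betw g {a \<in> edges X. ini X a = \<sigma>} {a' \<in> edges Y. ini Y a' = f \<sigma>})"

text \<open>As for \<^const>\<open>BijGroup\<close>, automorphisms are made extensional, so that equality in
  the group is equality on vertices and edges.\<close>

definition scwol_Aut :: "('v, 'e) scwol_data \<Rightarrow> (('v \<Rightarrow> 'v) \<times> ('e \<Rightarrow> 'e)) monoid" where
  "scwol_Aut X =
    \<lparr>carrier = {(f, g). f \<in> Bij (vertices X) \<and> g \<in> Bij (edges X) \<and> scwol_morphism X X f g},
     mult = (\<lambda>(f, g) (f', g'). (compose (vertices X) f f', compose (edges X) g g')),
     one = (\<lambda>\<sigma>\<in>vertices X. \<sigma>, \<lambda>a\<in>edges X. a)\<rparr>"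

definition scwol_action ::
    "('h, 'z) monoid_scheme \<Rightarrow> ('v, 'e) scwol_data \<Rightarrow> ('h \<Rightarrow> ('v \<Rightarrow> 'v) \<times> ('e \<Rightarrow> 'e)) \<Rightarrow> bool" where
  "scwol_action H X \<phi> \<longleftrightarrow>
     group_hom H (scwol_Aut X) \<phi> \<and>
     (\<forall>h\<in>carrier H. \<forall>a\<in>edges X.
        fst (\<phi> h) (ini X a) \<noteq> ter X a \<and>
        (fst (\<phi> h) (ini X a) = ini X a \<longrightarrow> snd (\<phi> h) a = a))"

datatype 'e oriented = Fwd 'e | Bwd 'e

fun underlying :: "'e oriented \<Rightarrow> 'e" where
  "underlying (Fwd a) = a"
| "underlying (Bwd a) = a"

fun oini :: "('v, 'e) scwol_data \<Rightarrow> 'e oriented \<Rightarrow> 'v" where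
  "oini X (Fwd a) = ini X a"
| "oini X (Bwd a) = ter X a"

fun oter :: "('v, 'e) scwol_data \<Rightarrow> 'e oriented \<Rightarrow> 'v" where
  "oter X (Fwd a) = ter X a"
| "oter X (Bwd a) = ini X a"

fun edge_path :: "('v, 'e) scwol_data \<Rightarrow> 'v \<Rightarrow> 'e oriented list \<Rightarrow> 'v \<Rightarrow> bool" where
  "edge_path X \<sigma> [] \<tau> \<longleftrightarrow> \<sigma> = \<tau>"
| "edge_path X \<sigma> (e # es) \<tau> \<longleftrightarrow>
     underlying e \<in> edges X \<and> oini X e = \<sigma> \<and> edge_path X (oter X e) es \<tau>"

definition scwol_connected :: "('v, 'e) scwol_data \<Rightarrow> bool" where
  "scwol_connected X \<longleftrightarrow> (\<forall>\<sigma>\<in>vertices X. \<forall>\<tau>\<in>vertices X. \<exists>es. edge_path X \<sigma> es \<tau>)"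

section \<open>Complexes of groups\<close>

record ('v, 'e, 'g) cog_data =
  lgrp :: "'v \<Rightarrow> 'g monoid"
  lmap :: "'e \<Rightarrow> 'g \<Rightarrow> 'g"
  twist :: "'e \<Rightarrow> 'e \<Rightarrow> 'g"

locale complex_of_groups = scwol X
  for X :: "('v, 'e) scwol_data" +
  fixes C :: "('v, 'e, 'g) cog_data"
  assumes lgrp_group: "\<sigma> \<in> vertices X \<Longrightarrow> group (lgrp C \<sigma>)"
    and lmap_hom: "a \<in> edges X \<Longrightarrow> lmap C a \<in> hom (lgrp C (ini X a)) (lgrp C (ter X a))"
    and lmap_inj: "a \<in> edges X \<Longrightarrow> inj_on (lmap C a) (carrier (lgrp C (ini X a)))"
    and twist_closed: "(a, b) \<in> edge_pairs X \<Longrightarrow> twist C a b \<in> carrier (lgrp C (ter X a))"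
    and twist_conj: "(a, b) \<in> edge_pairs X \<Longrightarrow> g \<in> carrier (lgrp C (ini X b)) \<Longrightarrow>
      twist C a b \<otimes>\<^bsub>lgrp C (ter X a)\<^esub> lmap C (ecomp X a b) g
        \<otimes>\<^bsub>lgrp C (ter X a)\<^esub> inv\<^bsub>lgrp C (ter X a)\<^esub> twist C a b
      = lmap C a (lmap C b g)"
    and twist_cocycle: "(a, b, c) \<in> edge_triples X \<Longrightarrow>
      lmap C a (twist C b c) \<otimes>\<^bsub>lgrp C (ter X a)\<^esub> twist C a (ecomp X b c)
      = twist C a b \<otimes>\<^bsub>lgrp C (ter X a)\<^esub> twist C (ecomp X a b) c"

section \<open>Paths in a complex of groups and homotopy\<close>

text \<open>\<open>XPath \<sigma> g\<^sub>0 [(e\<^sub>1, g\<^sub>1), \<dots>, (e\<^sub>k, g\<^sub>k)]\<close> encodes \<open>(g\<^sub>0, e\<^sub>1, g\<^sub>1, \<dots>, e\<^sub>k, g\<^sub>k)\<close>.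
  The initial vertex is recorded explicitly because all local groups live in one type, so for
  \<open>k = 0\<close> the group element alone does not determine it.\<close>

datatype ('v, 'e, 'g) xpath =
  XPath (xini: 'v) (xhead: 'g) (xsteps: "('e oriented \<times> 'g) list")

definition xter :: "('v, 'e) scwol_data \<Rightarrow> ('v, 'e, 'g) xpath \<Rightarrow> 'v" where
  "xter X p = (if xsteps p = [] then xini p else oter X (fst (last (xsteps p))))"

fun valid_steps ::
    "('v, 'e) scwol_data \<Rightarrow> ('v, 'e, 'g) cog_data \<Rightarrow> 'v \<Rightarrow> ('e oriented \<times> 'g) list \<Rightarrow> bool" where
  "valid_steps X C \<sigma> [] \<longleftrightarrow> True"
| "valid_steps X C \<sigma> ((e, g) # es) \<longleftrightarrow>
     underlying e \<in> edges X \<and> oini X e = \<sigma> \<and> g \<in> carrier (lgrp C (oter X e)) \<and>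
     valid_steps X C (oter X e) es"

definition xpaths ::
    "('v, 'e) scwol_data \<Rightarrow> ('v, 'e, 'g) cog_data \<Rightarrow> ('v, 'e, 'g) xpath set" where
  "xpaths X C = {p. xini p \<in> vertices X \<and> xhead p \<in> carrier (lgrp C (xini p)) \<and>
                    valid_steps X C (xini p) (xsteps p)}"

definition xpaths_from ::
    "('v, 'e) scwol_data \<Rightarrow> ('v, 'e, 'g) cog_data \<Rightarrow> 'v \<Rightarrow> ('v, 'e, 'g) xpath set" where
  "xpaths_from X C \<sigma> = {p \<in> xpaths X C. xini p = \<sigma>}"

definition xloops ::
    "('v, 'e) scwol_data \<Rightarrow> ('v, 'e, 'g) cog_data \<Rightarrow> 'v \<Rightarrow> ('v, 'e, 'g) xpath set" where
  "xloops X C \<sigma> = {p \<in> xpaths_from X C \<sigma>. xter X p = \<sigma>}"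

definition xcat ::
    "('v, 'e) scwol_data \<Rightarrow> ('v, 'e, 'g) cog_data \<Rightarrow>
     ('v, 'e, 'g) xpath \<Rightarrow> ('v, 'e, 'g) xpath \<Rightarrow> ('v, 'e, 'g) xpath" where
  "xcat X C p q =
    (if xsteps p = []
     then XPath (xini p) (xhead p \<otimes>\<^bsub>lgrp C (xini p)\<^esub> xhead q) (xsteps q)
     else XPath (xini p) (xhead p)
            (butlast (xsteps p) @
             [(fst (last (xsteps p)), snd (last (xsteps p)) \<otimes>\<^bsub>lgrp C (xter X p)\<^esub> xhead q)] @
             xsteps q))"

definition vertex_xpath :: "'v \<Rightarrow> 'g \<Rightarrow> ('v, 'e, 'g) xpath" where
  "vertex_xpath \<sigma> g = XPath \<sigma> g []"

text \<open>The paths \<open>(1, a, 1)\<close> and \<open>(1, b, 1, a, 1)\<close>:\<close>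

definition edge_xpath ::
    "('v, 'e) scwol_data \<Rightarrow> ('v, 'e, 'g) cog_data \<Rightarrow> 'e \<Rightarrow> ('v, 'e, 'g) xpath" where
  "edge_xpath X C a =
    XPath (ini X a) \<one>\<^bsub>lgrp C (ini X a)\<^esub> [(Fwd a, \<one>\<^bsub>lgrp C (ter X a)\<^esub>)]"

definition edge2_xpath ::
    "('v, 'e) scwol_data \<Rightarrow> ('v, 'e, 'g) cog_data \<Rightarrow> 'e \<Rightarrow> 'e \<Rightarrow> ('v, 'e, 'g) xpath" where
  "edge2_xpath X C b a =
    XPath (ini X b) \<one>\<^bsub>lgrp C (ini X b)\<^esub>
      [(Fwd b, \<one>\<^bsub>lgrp C (ter X b)\<^esub>), (Fwd a, \<one>\<^bsub>lgrp C (ter X a)\<^esub>)]"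

inductive elem_move ::
    "('v, 'e) scwol_data \<Rightarrow> ('v, 'e, 'g) cog_data \<Rightarrow>
     ('v, 'e, 'g) xpath \<Rightarrow> ('v, 'e, 'g) xpath \<Rightarrow> bool"
  for X C where
  push_fwd:
    "\<lbrakk>a \<in> edges X; k \<in> carrier (lgrp C (ini X a)); g \<in> carrier (lgrp C (ini X a));
      h \<in> carrier (lgrp C (ter X a))\<rbrakk> \<Longrightarrow>
     elem_move X C
       (XPath (ini X a) (k \<otimes>\<^bsub>lgrp C (ini X a)\<^esub> g) [(Fwd a, h)])
       (XPath (ini X a) k [(Fwd a, lmap C a g \<otimes>\<^bsub>lgrp C (ter X a)\<^esub> h)])"
| push_bwd:
    "\<lbrakk>a \<in> edges X; g \<in> carrier (lgrp C (ter X a)); h \<in> carrier (lgrp C (ini X a));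
      k \<in> carrier (lgrp C (ini X a))\<rbrakk> \<Longrightarrow>
     elem_move X C
       (XPath (ter X a) g [(Bwd a, h \<otimes>\<^bsub>lgrp C (ini X a)\<^esub> k)])
       (XPath (ter X a) (g \<otimes>\<^bsub>lgrp C (ter X a)\<^esub> lmap C a h) [(Bwd a, k)])"
| cancel_fwd_bwd:
    "\<lbrakk>a \<in> edges X; g \<in> carrier (lgrp C (ini X a)); h \<in> carrier (lgrp C (ini X a));
      k \<in> carrier (lgrp C (ini X a))\<rbrakk> \<Longrightarrow>
     elem_move X C
       (XPath (ini X a) g [(Fwd a, lmap C a h), (Bwd a, k)])
       (XPath (ini X a) (g \<otimes>\<^bsub>lgrp C (ini X a)\<^esub> h \<otimes>\<^bsub>lgrp C (ini X a)\<^esub> k) [])"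
| cancel_bwd_fwd:
    "\<lbrakk>b \<in> edges X; g \<in> carrier (lgrp C (ter X b)); h \<in> carrier (lgrp C (ini X b));
      k \<in> carrier (lgrp C (ter X b))\<rbrakk> \<Longrightarrow>
     elem_move X C
       (XPath (ter X b) g [(Bwd b, h), (Fwd b, k)])
       (XPath (ter X b) (g \<otimes>\<^bsub>lgrp C (ter X b)\<^esub> lmap C b h \<otimes>\<^bsub>lgrp C (ter X b)\<^esub> k) [])"
| compose_fwd:
    "\<lbrakk>(a, b) \<in> edge_pairs X; g \<in> carrier (lgrp C (ini X b)); k \<in> carrier (lgrp C (ter X a))\<rbrakk> \<Longrightarrow>
     elem_move X C
       (XPath (ini X b) g [(Fwd b, \<one>\<^bsub>lgrp C (ter X b)\<^esub>), (Fwd a, k)])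
       (XPath (ini X b) g
         [(Fwd (ecomp X a b),
           inv\<^bsub>lgrp C (ter X a)\<^esub> twist C a b \<otimes>\<^bsub>lgrp C (ter X a)\<^esub> k)])"
| compose_bwd:
    "\<lbrakk>(a, b) \<in> edge_pairs X; g \<in> carrier (lgrp C (ter X a)); k \<in> carrier (lgrp C (ini X b))\<rbrakk> \<Longrightarrow>
     elem_move X C
       (XPath (ter X a) g [(Bwd a, \<one>\<^bsub>lgrp C (ini X a)\<^esub>), (Bwd b, k)])
       (XPath (ter X a) (g \<otimes>\<^bsub>lgrp C (ter X a)\<^esub> twist C a b) [(Bwd (ecomp X a b), k)])"

text \<open>Replacing a subpath is expressed by concatenating with arbitrary paths on both sides; the
  moves are stable under multiplying the outer group elements, so no further identifications
  arise when the outer elements of the context are not trivial.\<close>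

inductive homotopy_step ::
    "('v, 'e) scwol_data \<Rightarrow> ('v, 'e, 'g) cog_data \<Rightarrow>
     ('v, 'e, 'g) xpath \<Rightarrow> ('v, 'e, 'g) xpath \<Rightarrow> bool"
  for X C where
  "\<lbrakk>elem_move X C s s'; p \<in> xpaths X C; q \<in> xpaths X C; xter X p = xini s; xter X s = xini q\<rbrakk> \<Longrightarrow>
   homotopy_step X C (xcat X C (xcat X C p s) q) (xcat X C (xcat X C p s') q)"

definition homotopy ::
    "('v, 'e) scwol_data \<Rightarrow> ('v, 'e, 'g) cog_data \<Rightarrow>
     (('v, 'e, 'g) xpath \<times> ('v, 'e, 'g) xpath) set" where
  "homotopy X C =
    {(p, q). p \<in> xpaths X C \<and> q \<in> xpaths X C \<and> equivclp (homotopy_step X C) p q}"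

definition hclass ::
    "('v, 'e) scwol_data \<Rightarrow> ('v, 'e, 'g) cog_data \<Rightarrow>
     ('v, 'e, 'g) xpath \<Rightarrow> ('v, 'e, 'g) xpath set" where
  "hclass X C p = homotopy X C `` {p}"

definition cog_pi1 ::
    "('v, 'e) scwol_data \<Rightarrow> ('v, 'e, 'g) cog_data \<Rightarrow> 'v \<Rightarrow> ('v, 'e, 'g) xpath set monoid" where
  "cog_pi1 X C \<sigma> =
    \<lparr>carrier = {hclass X C p | p. p \<in> xloops X C \<sigma>},
     mult = (\<lambda>x y. \<Union>p\<in>x. \<Union>q\<in>y. hclass X C (xcat X C p q)),
     one = hclass X C (vertex_xpath \<sigma> \<one>\<^bsub>lgrp C \<sigma>\<^esub>)\<rparr>"

text \<open>Equivalently, the complex of groups is isomorphic to one arising from a group action on a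
  scwol.\<close>

definition developable :: "('v, 'e) scwol_data \<Rightarrow> ('v, 'e, 'g) cog_data \<Rightarrow> bool" where
  "developable X C \<longleftrightarrow>
     (\<forall>\<sigma>\<in>vertices X. inj_on (\<lambda>g. hclass X C (vertex_xpath \<sigma> g)) (carrier (lgrp C \<sigma>)))"

section \<open>The universal development\<close>

definition dev_rel ::
    "('v, 'e) scwol_data \<Rightarrow> ('v, 'e, 'g) cog_data \<Rightarrow> 'v \<Rightarrow>
     (('v, 'e, 'g) xpath \<times> ('v, 'e, 'g) xpath) set" where
  "dev_rel X C \<sigma> =
    {(p, q). p \<in> xpaths_from X C \<sigma> \<and> q \<in> xpaths_from X C \<sigma> \<and>
       (\<exists>g\<in>carrier (lgrp C (xter X p)).
          hclass X C q = hclass X C (xcat X C p (vertex_xpath (xter X p) g)))}"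

definition dev_class ::
    "('v, 'e) scwol_data \<Rightarrow> ('v, 'e, 'g) cog_data \<Rightarrow> 'v \<Rightarrow>
     ('v, 'e, 'g) xpath \<Rightarrow> ('v, 'e, 'g) xpath set" where
  "dev_class X C \<sigma> p = dev_rel X C \<sigma> `` {p}"

type_synonym ('v, 'e, 'g) dev_vertex = "('v, 'e, 'g) xpath set"
type_synonym ('v, 'e, 'g) dev_edge = "('v, 'e, 'g) dev_vertex \<times> 'e \<times> ('v, 'e, 'g) dev_vertex"

definition dev_vertices ::
    "('v, 'e) scwol_data \<Rightarrow> ('v, 'e, 'g) cog_data \<Rightarrow> 'v \<Rightarrow> ('v, 'e, 'g) dev_vertex set" where
  "dev_vertices X C \<sigma> = {dev_class X C \<sigma> p | p. p \<in> xpaths_from X C \<sigma>}"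

definition dev_edges ::
    "('v, 'e) scwol_data \<Rightarrow> ('v, 'e, 'g) cog_data \<Rightarrow> 'v \<Rightarrow> ('v, 'e, 'g) dev_edge set" where
  "dev_edges X C \<sigma> =
    {(dev_class X C \<sigma> p, a, dev_class X C \<sigma> (xcat X C p (edge_xpath X C a))) | p a.
       p \<in> xpaths_from X C \<sigma> \<and> a \<in> edges X \<and> ini X a = xter X p}"

text \<open>Assignments on classes that are given through representatives are introduced as relations,
  so that their well-definedness can be asserted by \<open>is_map\<close>; \<open>map_of_graph\<close> is the map that
  such a relation defines.\<close>

definition is_map :: "('a \<times> 'b) set \<Rightarrow> 'a set \<Rightarrow> 'b set \<Rightarrow> bool" where
  "is_map R A B \<longleftrightarrow> R \<subseteq> A \<times> B \<and> (\<forall>x\<in>A. \<exists>!y. (x, y) \<in> R)"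

definition map_of_graph :: "('a \<times> 'b) set \<Rightarrow> 'a \<Rightarrow> 'b" where
  "map_of_graph R x = (THE y. (x, y) \<in> R)"

definition dev_comp_graph ::
    "('v, 'e) scwol_data \<Rightarrow> ('v, 'e, 'g) cog_data \<Rightarrow> 'v \<Rightarrow>
     ((('v, 'e, 'g) dev_edge \<times> ('v, 'e, 'g) dev_edge) \<times> ('v, 'e, 'g) dev_edge) set" where
  "dev_comp_graph X C \<sigma> =
    {(((dev_class X C \<sigma> (xcat X C p (edge_xpath X C b)), a,
        dev_class X C \<sigma> (xcat X C p (edge2_xpath X C b a))),
       (dev_class X C \<sigma> p, b, dev_class X C \<sigma> (xcat X C p (edge_xpath X C b)))),
      (dev_class X C \<sigma> p, ecomp X a b,
       dev_class X C \<sigma> (xcat X C p (edge_xpath X C (ecomp X a b))))) | p a b.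
       p \<in> xpaths_from X C \<sigma> \<and> (a, b) \<in> edge_pairs X \<and> ini X b = xter X p}"

definition development ::
    "('v, 'e) scwol_data \<Rightarrow> ('v, 'e, 'g) cog_data \<Rightarrow> 'v \<Rightarrow>
     (('v, 'e, 'g) dev_vertex, ('v, 'e, 'g) dev_edge) scwol_data" where
  "development X C \<sigma> =
    \<lparr>vertices = dev_vertices X C \<sigma>,
     edges = dev_edges X C \<sigma>,
     ini = (\<lambda>(v, a, w). v),
     ter = (\<lambda>(v, a, w). w),
     ecomp = (\<lambda>x y. map_of_graph (dev_comp_graph X C \<sigma>) (x, y))\<rparr>"

definition dev_vertex_act_graph ::
    "('v, 'e) scwol_data \<Rightarrow> ('v, 'e, 'g) cog_data \<Rightarrow> 'v \<Rightarrow>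
     ((('v, 'e, 'g) xpath set \<times> ('v, 'e, 'g) dev_vertex) \<times> ('v, 'e, 'g) dev_vertex) set" where
  "dev_vertex_act_graph X C \<sigma> =
    {((hclass X C q, dev_class X C \<sigma> p), dev_class X C \<sigma> (xcat X C q p)) | q p.
       q \<in> xloops X C \<sigma> \<and> p \<in> xpaths_from X C \<sigma>}"

definition dev_edge_act_graph ::
    "('v, 'e) scwol_data \<Rightarrow> ('v, 'e, 'g) cog_data \<Rightarrow> 'v \<Rightarrow>
     ((('v, 'e, 'g) xpath set \<times> ('v, 'e, 'g) dev_edge) \<times> ('v, 'e, 'g) dev_edge) set" where
  "dev_edge_act_graph X C \<sigma> =
    {((hclass X C q,
       (dev_class X C \<sigma> p, a, dev_class X C \<sigma> (xcat X C p (edge_xpath X C a)))),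
      (dev_class X C \<sigma> (xcat X C q p), a,
       dev_class X C \<sigma> (xcat X C (xcat X C q p) (edge_xpath X C a)))) | q p a.
       q \<in> xloops X C \<sigma> \<and> p \<in> xpaths_from X C \<sigma> \<and> a \<in> edges X \<and> ini X a = xter X p}"

definition dev_act ::
    "('v, 'e) scwol_data \<Rightarrow> ('v, 'e, 'g) cog_data \<Rightarrow> 'v \<Rightarrow> ('v, 'e, 'g) xpath set \<Rightarrow>
     (('v, 'e, 'g) dev_vertex \<Rightarrow> ('v, 'e, 'g) dev_vertex) \<times>
     (('v, 'e, 'g) dev_edge \<Rightarrow> ('v, 'e, 'g) dev_edge)" where
  "dev_act X C \<sigma> h =
    (\<lambda>v\<in>dev_vertices X C \<sigma>. map_of_graph (dev_vertex_act_graph X C \<sigma>) (h, v),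
     \<lambda>x\<in>dev_edges X C \<sigma>. map_of_graph (dev_edge_act_graph X C \<sigma>) (h, x))"

end

theory Submission
  imports Defs
begin

text \<open>
  Homotopy is a congruence for concatenation, and every path has an inverse up to homotopy, so
  homotopy classes form a groupoid. Since \<open>(g, a, 1) \<sim> (1, a, \<psi>\<^sub>a(g))\<close>, the class of
  \<open>p \<star> (1, a, 1)\<close> depends only on that of \<open>p\<close>. An edge of the development is therefore determined by
  its initial vertex and the edge \<open>a\<close> of \<open>X\<close> below it, which gives uniqueness of composites,
  associativity, and the bijections between stars. The terminal vertex of a path is an invariant
  of its class; this excludes loops and inversions, because \<open>X\<close> has no loops. Left
  concatenation commutes with extension by an edge, so it acts on the development.
\<close>

section \<open>Concatenation of paths\<close>

text \<open>The path \<open>(1, b, 1, a, 1)\<close> is homotopic to \<open>(1, ab, 1)\<close> only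
  up to a factor, the inverse of the twisting element. This factor sits at the end of the path,
  where the passage from homotopy classes to \<equiv>-classes absorbs it; hence composition lives on
  the latter.

  Composition and action are given through representatives. Each graph is rewritten as the image of
  an explicit index set of representatives, so that being well-defined becomes one implication
  between equal arguments and equal values. What makes these index sets manageable is that an edge
  starting at the class of \<open>p\<close> can be rewritten with \<open>p\<close> itself as its
  representative.

  Concatenation is defined at the last step of the left path, whereas validity and the inductions
  begin at the first step. Once this is bridged, paths are mostly treated as products of group
  elements and single oriented edges, without opening lists.\<close>

lemma xcat_Nil [simp]:
  "xcat X C (XPath \<sigma> g []) q = XPath \<sigma> (g \<otimes>\<^bsub>lgrp C \<sigma>\<^esub> xhead q) (xsteps q)"
  by (simp add: xcat_def)

text \<open>Recursion from the front for an operation defined at the back: only the head of the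
  recursive result can have changed, so the first step is rebuilt from that head.\<close>

lemma xcat_Cons [simp]:
  "xcat X C (XPath \<sigma> g ((e, h) # es)) q =
    (let r = xcat X C (XPath (oter X e) h es) q in XPath \<sigma> g ((e, xhead r) # xsteps r))"
  by (simp add: xcat_def xter_def Let_def)

lemma xter_Nil [simp]: "xter X (XPath \<sigma> g []) = \<sigma>"
  by (simp add: xter_def)

lemma xter_Cons [simp]: "xter X (XPath \<sigma> g ((e, h) # es)) = xter X (XPath (oter X e) h es)"
  by (simp add: xter_def)

lemma xini_xcat [simp]: "xini (xcat X C p q) = xini p"
  by (simp add: xcat_def)

lemma xter_xcat: "xter X p = xini q \<Longrightarrow> xter X (xcat X C p q) = xter X q"
proof (induction "xsteps p" arbitrary: p)
  case Nil
  then show ?case by (cases p) (simp add: xter_def)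
next
  case (Cons s es)
  obtain e h where s: "s = (e, h)" by force
  obtain \<sigma> g where p: "p = XPath \<sigma> g ((e, h) # es)" using Cons.hyps(2) s by (cases p) simp
  have "xter X (xcat X C (XPath (oter X e) h es) q) = xter X q"
    by (rule Cons.hyps(1)) (use Cons.prems p in simp_all)
  moreover have "xini (xcat X C (XPath (oter X e) h es) q) = oter X e" by simp
  ultimately show ?case
    unfolding p by (cases "xcat X C (XPath (oter X e) h es) q") (simp add: Let_def)
qed

lemma edge_path_append:
  "edge_path X \<sigma> es \<tau> \<Longrightarrow> edge_path X \<tau> fs \<rho> \<Longrightarrow> edge_path X \<sigma> (es @ fs) \<rho>"
  by (induction es arbitrary: \<sigma>) auto

lemma edge_path_reverse: "edge_path X \<sigma> es \<tau> \<Longrightarrow> \<exists>fs. edge_path X \<tau> fs \<sigma>"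
proof (induction es arbitrary: \<sigma>)
  case Nil
  then show ?case by (intro exI[of _ "[]"]) simp
next
  case (Cons e es)
  then obtain fs where "edge_path X \<tau> fs (oter X e)" by auto
  moreover have "\<exists>e'. edge_path X (oter X e) [e'] \<sigma>"
    using Cons.prems by (cases e) (auto intro: exI[of _ "Fwd _"] exI[of _ "Bwd _"])
  ultimately show ?case using edge_path_append by metis
qed

context scwol
begin

lemma oini_closed: "underlying e \<in> edges X \<Longrightarrow> oini X e \<in> vertices X"
  by (cases e) (simp_all add: ini_closed ter_closed)

lemma oter_closed: "underlying e \<in> edges X \<Longrightarrow> oter X e \<in> vertices X"
  by (cases e) (simp_all add: ini_closed ter_closed)

end

context complex_of_groups
begin

abbreviation cat (infixl "\<star>" 70) where "p \<star> q \<equiv> xcat X C p q"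

abbreviation homotopic (infix "\<approx>" 50) where "p \<approx> q \<equiv> (p, q) \<in> homotopy X C"

text \<open>One notion for both orientations, so that inductions over generators need no case split;
  on forward edges it is \<open>edge_xpath\<close>.\<close>

definition oedge_xpath :: "'e oriented \<Rightarrow> ('v, 'e, 'g) xpath" where
  "oedge_xpath e =
    XPath (oini X e) \<one>\<^bsub>lgrp C (oini X e)\<^esub> [(e, \<one>\<^bsub>lgrp C (oter X e)\<^esub>)]"

abbreviation one_xpath :: "'v \<Rightarrow> ('v, 'e, 'g) xpath" where
  "one_xpath \<sigma> \<equiv> vertex_xpath \<sigma> \<one>\<^bsub>lgrp C \<sigma>\<^esub>"

lemma lgrp_one_closed [simp]: "\<sigma> \<in> vertices X \<Longrightarrow> \<one>\<^bsub>lgrp C \<sigma>\<^esub> \<in> carrier (lgrp C \<sigma>)"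
  by (intro monoid.one_closed group.is_monoid lgrp_group)

lemma lgrp_m_closed [simp]:
  "\<sigma> \<in> vertices X \<Longrightarrow> g \<in> carrier (lgrp C \<sigma>) \<Longrightarrow> h \<in> carrier (lgrp C \<sigma>) \<Longrightarrow>
    g \<otimes>\<^bsub>lgrp C \<sigma>\<^esub> h \<in> carrier (lgrp C \<sigma>)"
  by (intro monoid.m_closed group.is_monoid lgrp_group)

lemma lgrp_inv_closed [simp]:
  "\<sigma> \<in> vertices X \<Longrightarrow> g \<in> carrier (lgrp C \<sigma>) \<Longrightarrow> inv\<^bsub>lgrp C \<sigma>\<^esub> g \<in> carrier (lgrp C \<sigma>)"
  by (intro group.inv_closed lgrp_group)

lemma lgrp_r_inv [simp]:
  "\<sigma> \<in> vertices X \<Longrightarrow> g \<in> carrier (lgrp C \<sigma>) \<Longrightarrow> g \<otimes>\<^bsub>lgrp C \<sigma>\<^esub> inv\<^bsub>lgrp C \<sigma>\<^esub> g = \<one>\<^bsub>lgrp C \<sigma>\<^esub>"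
  by (intro group.r_inv lgrp_group)

lemma lgrp_l_inv [simp]:
  "\<sigma> \<in> vertices X \<Longrightarrow> g \<in> carrier (lgrp C \<sigma>) \<Longrightarrow> inv\<^bsub>lgrp C \<sigma>\<^esub> g \<otimes>\<^bsub>lgrp C \<sigma>\<^esub> g = \<one>\<^bsub>lgrp C \<sigma>\<^esub>"
  by (intro group.l_inv lgrp_group)

lemma lgrp_r_one [simp]:
  "\<sigma> \<in> vertices X \<Longrightarrow> g \<in> carrier (lgrp C \<sigma>) \<Longrightarrow> g \<otimes>\<^bsub>lgrp C \<sigma>\<^esub> \<one>\<^bsub>lgrp C \<sigma>\<^esub> = g"
  by (intro monoid.r_one group.is_monoid lgrp_group)

lemma lgrp_l_one [simp]:
  "\<sigma> \<in> vertices X \<Longrightarrow> g \<in> carrier (lgrp C \<sigma>) \<Longrightarrow> \<one>\<^bsub>lgrp C \<sigma>\<^esub> \<otimes>\<^bsub>lgrp C \<sigma>\<^esub> g = g"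
  by (intro monoid.l_one group.is_monoid lgrp_group)

lemma lgrp_m_assoc:
  "\<sigma> \<in> vertices X \<Longrightarrow> g \<in> carrier (lgrp C \<sigma>) \<Longrightarrow> h \<in> carrier (lgrp C \<sigma>) \<Longrightarrow>
    k \<in> carrier (lgrp C \<sigma>) \<Longrightarrow>
    g \<otimes>\<^bsub>lgrp C \<sigma>\<^esub> h \<otimes>\<^bsub>lgrp C \<sigma>\<^esub> k = g \<otimes>\<^bsub>lgrp C \<sigma>\<^esub> (h \<otimes>\<^bsub>lgrp C \<sigma>\<^esub> k)"
  by (intro monoid.m_assoc group.is_monoid lgrp_group)

lemma lmap_closed [simp]:
  "a \<in> edges X \<Longrightarrow> g \<in> carrier (lgrp C (ini X a)) \<Longrightarrow> lmap C a g \<in> carrier (lgrp C (ter X a))"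
  using lmap_hom by (auto simp: hom_def)

lemma lmap_one [simp]:
  assumes "a \<in> edges X"
  shows "lmap C a \<one>\<^bsub>lgrp C (ini X a)\<^esub> = \<one>\<^bsub>lgrp C (ter X a)\<^esub>"
  using assms lmap_hom ini_closed ter_closed lgrp_group by (auto intro: hom_one)

declare ini_closed [simp] ter_closed [simp] oini_closed [simp] oter_closed [simp]

lemma edge_pairsD:
  assumes "(a, b) \<in> edge_pairs X"
  shows "a \<in> edges X" "b \<in> edges X" "ini X a = ter X b"
    "ecomp X a b \<in> edges X" "ini X (ecomp X a b) = ini X b" "ter X (ecomp X a b) = ter X a"
  using assms ecomp_closed ini_ecomp ter_ecomp by (auto simp: edge_pairs_def)

lemma xpaths_Nil [simp]:
  "XPath \<sigma> g [] \<in> xpaths X C \<longleftrightarrow> \<sigma> \<in> vertices X \<and> g \<in> carrier (lgrp C \<sigma>)"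
  by (auto simp: xpaths_def)

lemma xpaths_Cons [simp]:
  "XPath \<sigma> g ((e, h) # es) \<in> xpaths X C \<longleftrightarrow>
    underlying e \<in> edges X \<and> oini X e = \<sigma> \<and> g \<in> carrier (lgrp C \<sigma>) \<and>
    XPath (oter X e) h es \<in> xpaths X C"
  by (auto simp: xpaths_def)

lemma xpathsD [simp]:
  "p \<in> xpaths X C \<Longrightarrow> xini p \<in> vertices X"
  "p \<in> xpaths X C \<Longrightarrow> xhead p \<in> carrier (lgrp C (xini p))"
  by (auto simp: xpaths_def)

text \<open>The remainder \<open>r\<close> is again a path and the whole is expressed through its
  head and steps, which is the form that \<open>xcat_Cons\<close> produces.\<close>

lemma xpath_induct [consumes 1, case_names vertex step]:
  assumes "p \<in> xpaths X C"
    and vertex: "\<And>\<sigma> g. \<sigma> \<in> vertices X \<Longrightarrow> g \<in> carrier (lgrp C \<sigma>) \<Longrightarrow> P (XPath \<sigma> g [])"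
    and step: "\<And>g e r. underlying e \<in> edges X \<Longrightarrow> g \<in> carrier (lgrp C (oini X e)) \<Longrightarrow>
      r \<in> xpaths X C \<Longrightarrow> xini r = oter X e \<Longrightarrow> P r \<Longrightarrow>
      P (XPath (oini X e) g ((e, xhead r) # xsteps r))"
  shows "P p"
  using assms(1)
proof (induction "xsteps p" arbitrary: p)
  case Nil
  then show ?case using vertex by (cases p) simp
next
  case (Cons s es)
  obtain e h where s: "s = (e, h)" by force
  obtain g where p: "p = XPath (oini X e) g ((e, h) # es)"
    using Cons.hyps(2) Cons.prems s by (cases p) auto
  have "P (XPath (oter X e) h es)" using Cons p by simp
  then show ?case
    using step[of e g "XPath (oter X e) h es"] Cons.prems p by simp
qed

lemma xter_closed [simp]: "p \<in> xpaths X C \<Longrightarrow> xter X p \<in> vertices X"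
proof (induction rule: xpath_induct)
  case (step g e r)
  then show ?case by (cases r) simp
qed simp

lemma xcat_closed [simp]:
  assumes "p \<in> xpaths X C" "q \<in> xpaths X C" "xter X p = xini q"
  shows "p \<star> q \<in> xpaths X C"
  using assms(1,3)
proof (induction rule: xpath_induct)
  case (vertex \<sigma> g)
  then show ?case using assms(2) by (simp add: xpaths_def del: xpathsD)
next
  case (step g e r)
  obtain h es where r: "r = XPath (oter X e) h es" using step(4) by (cases r) simp
  have "r \<star> q \<in> xpaths X C" using step r by simp
  moreover obtain k fs where "r \<star> q = XPath (oter X e) k fs"
    using step(4) xini_xcat[of X C r q] by (cases "r \<star> q") simp
  ultimately show ?case
    using step(1,2) r by (simp add: Let_def)
qed

lemma xcat_assoc:
  assumes "p \<in> xpaths X C" "q \<in> xpaths X C" "r \<in> xpaths X C"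
    and "xter X p = xini q" "xter X q = xini r"
  shows "p \<star> q \<star> r = p \<star> (q \<star> r)"
  using assms(1,4)
proof (induction rule: xpath_induct)
  case (vertex \<sigma> g)
  \<comment> \<open>Only when \<open>q\<close> has no steps do three group elements meet at one
    place; this is where associativity in the local group enters.\<close>
  with assms show ?case
    by (cases q; cases "xsteps q") (auto simp: lgrp_m_assoc Let_def)
next
  case (step g e p)
  obtain h es where p: "p = XPath (oter X e) h es" using step(4) by (cases p) simp
  have "p \<star> q \<star> r = p \<star> (q \<star> r)" using step p by simp
  moreover obtain k fs where "p \<star> q = XPath (oter X e) k fs"
    using step(4) xini_xcat[of X C p q] by (cases "p \<star> q") simp
  ultimately show ?case
    using p by (simp add: Let_def)
qed

lemma vertex_xpath_closed [simp]:
  "\<sigma> \<in> vertices X \<Longrightarrow> g \<in> carrier (lgrp C \<sigma>) \<Longrightarrow> vertex_xpath \<sigma> g \<in> xpaths X C"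
  by (simp add: vertex_xpath_def)

lemma xini_vertex_xpath [simp]: "xini (vertex_xpath \<sigma> g) = \<sigma>"
  by (simp add: vertex_xpath_def)

lemma xter_vertex_xpath [simp]: "xter X (vertex_xpath \<sigma> g) = \<sigma>"
  by (simp add: vertex_xpath_def)

lemma one_xpath_cat [simp]: "p \<in> xpaths X C \<Longrightarrow> xini p = \<sigma> \<Longrightarrow> one_xpath \<sigma> \<star> p = p"
  by (cases p) (auto simp: vertex_xpath_def xpaths_def simp del: xpathsD)

lemma cat_one_xpath [simp]: "p \<in> xpaths X C \<Longrightarrow> xter X p = \<sigma> \<Longrightarrow> p \<star> one_xpath \<sigma> = p"
proof (induction rule: xpath_induct)
  case (step g e r)
  then show ?case by (cases r) (simp add: Let_def)
qed (simp add: vertex_xpath_def)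

lemma vertex_xpath_cat:
  "vertex_xpath \<sigma> g \<star> vertex_xpath \<sigma> h = vertex_xpath \<sigma> (g \<otimes>\<^bsub>lgrp C \<sigma>\<^esub> h)"
  by (simp add: vertex_xpath_def)

lemma oedge_xpath_closed [simp]: "underlying e \<in> edges X \<Longrightarrow> oedge_xpath e \<in> xpaths X C"
  by (simp add: oedge_xpath_def)

lemma xini_oedge_xpath [simp]: "xini (oedge_xpath e) = oini X e"
  by (simp add: oedge_xpath_def)

lemma xter_oedge_xpath [simp]: "xter X (oedge_xpath e) = oter X e"
  by (simp add: oedge_xpath_def)

lemma edge_xpath_eq: "edge_xpath X C a = oedge_xpath (Fwd a)"
  by (simp add: edge_xpath_def oedge_xpath_def)

lemma edge_xpath_closed [simp]: "a \<in> edges X \<Longrightarrow> edge_xpath X C a \<in> xpaths X C"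
  by (simp add: edge_xpath_def)

lemma xini_edge_xpath [simp]: "xini (edge_xpath X C a) = ini X a"
  by (simp add: edge_xpath_def)

lemma xter_edge_xpath [simp]: "xter X (edge_xpath X C a) = ter X a"
  by (simp add: edge_xpath_def)

lemma edge2_xpath_eq:
  "(a, b) \<in> edge_pairs X \<Longrightarrow> edge2_xpath X C b a = edge_xpath X C b \<star> edge_xpath X C a"
  using edge_pairsD[of a b] by (simp add: edge2_xpath_def edge_xpath_def Let_def)

lemma xpath_step_eq:
  assumes "underlying e \<in> edges X" "g \<in> carrier (lgrp C (oini X e))"
    "r \<in> xpaths X C" "xini r = oter X e"
  shows "XPath (oini X e) g ((e, xhead r) # xsteps r) =
    vertex_xpath (oini X e) g \<star> oedge_xpath e \<star> r"
  using assms xpathsD(2)[of r] by (simp add: vertex_xpath_def oedge_xpath_def Let_def)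

text \<open>Every path is a product of paths \<open>(g)\<close> and \<open>(1, e, 1)\<close>. The
  induction speaks of concatenation alone, which is compatible with homotopy.\<close>

lemma xpath_generator_induct [consumes 1, case_names vertex step]:
  assumes "p \<in> xpaths X C"
    and "\<And>\<sigma> g. \<sigma> \<in> vertices X \<Longrightarrow> g \<in> carrier (lgrp C \<sigma>) \<Longrightarrow> P (vertex_xpath \<sigma> g)"
    and "\<And>g e r. underlying e \<in> edges X \<Longrightarrow> g \<in> carrier (lgrp C (oini X e)) \<Longrightarrow>
      r \<in> xpaths X C \<Longrightarrow> xini r = oter X e \<Longrightarrow> P r \<Longrightarrow>
      P (vertex_xpath (oini X e) g \<star> oedge_xpath e \<star> r)"
  shows "P p"
  using assms(1)
proof (induction rule: xpath_induct)
  case (vertex \<sigma> g)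
  then show ?case using assms(2) by (simp add: vertex_xpath_def)
next
  case (step g e r)
  then show ?case using assms(3) xpath_step_eq by metis
qed

section \<open>Homotopy\<close>

lemma elem_move_xpaths:
  assumes "elem_move X C s s'"
  shows "s \<in> xpaths X C \<and> s' \<in> xpaths X C \<and> xini s' = xini s \<and> xter X s' = xter X s"
  using assms
proof cases
  case (compose_fwd a b g k)
  then show ?thesis using edge_pairsD[of a b] twist_closed[of a b] by simp
next
  case (compose_bwd a b g k)
  then show ?thesis using edge_pairsD[of a b] twist_closed[of a b] by simp
qed simp_all

lemma homotopy_step_xpaths:
  assumes "homotopy_step X C p q"
  shows "p \<in> xpaths X C \<and> q \<in> xpaths X C \<and> xini q = xini p \<and> xter X q = xter X p"
  using assms
proof cases
  case (1 s s' p' q')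
  with elem_move_xpaths[OF 1(3)] show ?thesis by (simp add: xter_xcat)
qed

text \<open>A step already carries an arbitrary context on each side, so by associativity
  \<open>r\<close> is merged into the right context.\<close>

lemma homotopy_step_cat_right:
  assumes "homotopy_step X C p q" "r \<in> xpaths X C" "xter X p = xini r"
  shows "homotopy_step X C (p \<star> r) (q \<star> r)"
  using assms(1)
proof cases
  case (1 s s' p' q')
  note s = elem_move_xpaths[OF 1(3)]
  have "xter X q' = xini r" using assms 1 s by (simp add: xter_xcat)
  then have "homotopy_step X C (p' \<star> s \<star> (q' \<star> r)) (p' \<star> s' \<star> (q' \<star> r))"
    using 1 assms(2) by (intro homotopy_step.intros) auto
  then show ?thesis
    using 1 s assms(2) \<open>xter X q' = xini r\<close> by (simp add: xcat_assoc xter_xcat)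
qed

lemma homotopy_step_cat_left:
  assumes "homotopy_step X C p q" "r \<in> xpaths X C" "xter X r = xini p"
  shows "homotopy_step X C (r \<star> p) (r \<star> q)"
  using assms(1)
proof cases
  case (1 s s' p' q')
  note s = elem_move_xpaths[OF 1(3)]
  have "xter X r = xini p'" using assms 1 s by simp
  then have "homotopy_step X C ((r \<star> p') \<star> s \<star> q') ((r \<star> p') \<star> s' \<star> q')"
    using 1 assms(2) by (intro homotopy_step.intros) (auto simp: xter_xcat)
  then show ?thesis
    using 1 s assms(2) \<open>xter X r = xini p'\<close> by (simp add: xcat_assoc xter_xcat)
qed

lemma homotopy_refl: "p \<in> xpaths X C \<Longrightarrow> p \<approx> p"
  by (simp add: homotopy_def)

lemma homotopy_sym: "p \<approx> q \<Longrightarrow> q \<approx> p"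
  by (auto simp: homotopy_def intro: equivclp_sym)

lemma homotopy_trans [trans]: "p \<approx> q \<Longrightarrow> q \<approx> r \<Longrightarrow> p \<approx> r"
  by (auto simp: homotopy_def intro: equivclp_trans)

lemma homotopy_if_step: "homotopy_step X C p q \<Longrightarrow> p \<approx> q"
  using homotopy_step_xpaths by (auto simp: homotopy_def)

text \<open>Separates steps applied forwards from steps applied backwards, and supplies
  \<open>p \<approx> q\<close> at each stage, from which the end points of \<open>q\<close> are
  known.\<close>

lemma homotopy_induct [consumes 1, case_names refl step unstep]:
  assumes "p \<approx> q" "P p"
    and "\<And>q r. p \<approx> q \<Longrightarrow> homotopy_step X C q r \<Longrightarrow> P q \<Longrightarrow> P r"
    and "\<And>q r. p \<approx> q \<Longrightarrow> homotopy_step X C r q \<Longrightarrow> P q \<Longrightarrow> P r"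
  shows "P q"
proof -
  have p: "p \<in> xpaths X C" and "equivclp (homotopy_step X C) p q"
    using assms(1) by (auto simp: homotopy_def)
  from this(2) have "P q \<and> p \<approx> q"
  proof (induction rule: equivclp_induct)
    case base
    then show ?case using assms(2) homotopy_refl[OF p] by simp
  next
    case (step y z)
    then show ?case
      using assms(3,4) homotopy_if_step homotopy_sym homotopy_trans by metis
  qed
  then show ?thesis by simp
qed

lemma homotopy_xpaths:
  assumes "p \<approx> q"
  shows "p \<in> xpaths X C" "q \<in> xpaths X C" "xini q = xini p" "xter X q = xter X p"
proof -
  show "p \<in> xpaths X C" "q \<in> xpaths X C" using assms by (auto simp: homotopy_def)
  have "xini q = xini p \<and> xter X q = xter X p"
    using assms by (induction rule: homotopy_induct) (use homotopy_step_xpaths in metis)+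
  then show "xini q = xini p" "xter X q = xter X p" by auto
qed

lemma homotopy_cat_right:
  assumes "p \<approx> q" "r \<in> xpaths X C" "xter X p = xini r"
  shows "p \<star> r \<approx> q \<star> r"
  using assms(1)
proof (induction rule: homotopy_induct)
  case refl
  then show ?case using assms homotopy_xpaths by (auto intro: homotopy_refl)
next
  case (step q s)
  then have "homotopy_step X C (q \<star> r) (s \<star> r)"
    using assms homotopy_xpaths by (intro homotopy_step_cat_right) auto
  then show ?case using step.IH homotopy_if_step homotopy_trans by blast
next
  case (unstep q s)
  then have "homotopy_step X C (s \<star> r) (q \<star> r)"
    using assms homotopy_xpaths homotopy_step_xpaths[of s q] by (intro homotopy_step_cat_right) auto
  then show ?case using unstep.IH homotopy_if_step homotopy_trans homotopy_sym by blast
qed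

lemma homotopy_cat_left:
  assumes "p \<approx> q" "r \<in> xpaths X C" "xter X r = xini p"
  shows "r \<star> p \<approx> r \<star> q"
  using assms(1)
proof (induction rule: homotopy_induct)
  case refl
  then show ?case using assms homotopy_xpaths by (auto intro: homotopy_refl)
next
  case (step q s)
  then have "homotopy_step X C (r \<star> q) (r \<star> s)"
    using assms homotopy_xpaths by (intro homotopy_step_cat_left) auto
  then show ?case using step.IH homotopy_if_step homotopy_trans by blast
next
  case (unstep q s)
  then have "homotopy_step X C (r \<star> s) (r \<star> q)"
    using assms homotopy_xpaths homotopy_step_xpaths[of s q] by (intro homotopy_step_cat_left) auto
  then show ?case using unstep.IH homotopy_if_step homotopy_trans homotopy_sym by blast
qed

lemma homotopy_cat:
  assumes "p \<approx> p'" "q \<approx> q'" "xter X p = xini q"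
  shows "p \<star> q \<approx> p' \<star> q'"
proof -
  have "p \<star> q \<approx> p' \<star> q" using assms homotopy_xpaths by (intro homotopy_cat_right) auto
  also have "p' \<star> q \<approx> p' \<star> q'"
    using assms homotopy_xpaths by (intro homotopy_cat_left) auto
  finally show ?thesis .
qed

lemma homotopy_if_move:
  assumes "elem_move X C s s'"
  shows "s \<approx> s'"
proof -
  note s = elem_move_xpaths[OF assms]
  \<comment> \<open>A step requires contexts; the trivial paths at the two ends of \<open>s\<close>
    are neutral ones.\<close>
  have "homotopy_step X C
    (one_xpath (xini s) \<star> s \<star> one_xpath (xter X s)) (one_xpath (xini s) \<star> s' \<star> one_xpath (xter X s))"
    using s by (intro homotopy_step.intros[OF assms]) auto
  then show ?thesis using s homotopy_if_step by simp
qed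

section \<open>Inverses of paths up to homotopy\<close>

fun oinv :: "'e oriented \<Rightarrow> 'e oriented" where
  "oinv (Fwd a) = Bwd a"
| "oinv (Bwd a) = Fwd a"

lemma oinv_simps [simp]:
  "underlying (oinv e) = underlying e" "oini X (oinv e) = oter X e" "oter X (oinv e) = oini X e"
  "oinv (oinv e) = e"
  by (cases e; simp)+

text \<open>The two cancellation moves with all group elements trivial; the middle element has the
  required form \<open>lmap C a h\<close> because \<open>lmap\<close> preserves the unit.\<close>

lemma oedge_xpath_inverse:
  assumes "underlying e \<in> edges X"
  shows "oedge_xpath e \<star> oedge_xpath (oinv e) \<approx> one_xpath (oini X e)"
proof (cases e)
  case (Fwd a)
  then show ?thesis
    using assms homotopy_if_move[OF elem_move.cancel_fwd_bwd[of a X "\<one>\<^bsub>lgrp C (ini X a)\<^esub>" C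
      "\<one>\<^bsub>lgrp C (ini X a)\<^esub>" "\<one>\<^bsub>lgrp C (ini X a)\<^esub>"]]
    by (simp add: vertex_xpath_def oedge_xpath_def)
next
  case (Bwd a)
  then show ?thesis
    using assms homotopy_if_move[OF elem_move.cancel_bwd_fwd[of a X "\<one>\<^bsub>lgrp C (ter X a)\<^esub>" C
      "\<one>\<^bsub>lgrp C (ini X a)\<^esub>" "\<one>\<^bsub>lgrp C (ter X a)\<^esub>"]]
    by (simp add: vertex_xpath_def oedge_xpath_def)
qed

text \<open>The inverse of a product is the product of the inverses in reverse order: the inner
  factors cancel first.\<close>

lemma cat_cancel_middle:
  assumes "p \<in> xpaths X C" "q \<in> xpaths X C" "p' \<in> xpaths X C" "q' \<in> xpaths X C"
    and "xter X p = xini q" "xter X q = xini q'" "xter X q' = xini p'"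
    and "q \<star> q' \<approx> one_xpath (xini q)" "p \<star> p' \<approx> one_xpath \<sigma>"
  shows "(p \<star> q) \<star> (q' \<star> p') \<approx> one_xpath \<sigma>"
proof -
  have q': "xter X q' = xini q"
    using homotopy_xpaths(4)[OF assms(8)] assms by (simp add: xter_xcat)
  have "(p \<star> q) \<star> (q' \<star> p') = p \<star> ((q \<star> q') \<star> p')"
    using assms by (simp add: xcat_assoc xter_xcat)
  also have "\<dots> \<approx> p \<star> (one_xpath (xini q) \<star> p')"
    using assms by (intro homotopy_cat_left homotopy_cat_right) (auto simp: xter_xcat)
  also have "p \<star> (one_xpath (xini q) \<star> p') = p \<star> p'" using assms q' by simp
  finally show ?thesis using assms(9) homotopy_trans by blast
qed

lemma xpath_inverse_right:
  assumes "p \<in> xpaths X C"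
  shows "\<exists>q \<in> xpaths X C. xini q = xter X p \<and> xter X q = xini p \<and> p \<star> q \<approx> one_xpath (xini p)"
  using assms
proof (induction rule: xpath_generator_induct)
  case (vertex \<sigma> g)
  then show ?case
    by (intro bexI[of _ "vertex_xpath \<sigma> (inv\<^bsub>lgrp C \<sigma>\<^esub> g)"])
      (auto simp: vertex_xpath_cat intro: homotopy_refl)
next
  case (step g e r)
  let ?\<sigma> = "oini X e"
  let ?g = "vertex_xpath ?\<sigma> g" and ?e = "oedge_xpath e"
  let ?g' = "vertex_xpath ?\<sigma> (inv\<^bsub>lgrp C ?\<sigma>\<^esub> g)" and ?e' = "oedge_xpath (oinv e)"
  obtain q where q: "q \<in> xpaths X C" "xini q = xter X r" "xter X q = xini r"
    "r \<star> q \<approx> one_xpath (xini r)"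
    using step.IH by auto
  have e: "?e \<in> xpaths X C" "?e' \<in> xpaths X C" using step by simp_all
  have g: "?g \<in> xpaths X C" "?g' \<in> xpaths X C" using step by auto
  have gg: "?g \<star> ?g' \<approx> one_xpath ?\<sigma>"
    using step by (simp add: vertex_xpath_cat homotopy_refl)
  have ge: "(?g \<star> ?e) \<star> (?e' \<star> ?g') \<approx> one_xpath ?\<sigma>"
    by (rule cat_cancel_middle) (use g e gg oedge_xpath_inverse[OF step(1)] in simp_all)
  have ge_xpaths: "?g \<star> ?e \<in> xpaths X C" "?e' \<star> ?g' \<in> xpaths X C"
    "xini (?g \<star> ?e) = ?\<sigma>" "xter X (?g \<star> ?e) = xini r"
    "xini (?e' \<star> ?g') = xini r" "xter X (?e' \<star> ?g') = ?\<sigma>"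
    using g e step by (simp_all add: xter_xcat)
  \<comment> \<open>Second use of \<open>cat_cancel_middle\<close>: the product of \<open>?g\<close>
    and \<open>?e\<close>, inverted just before, now encloses \<open>r\<close> and its inverse
    \<open>q\<close>.\<close>
  have "(?g \<star> ?e \<star> r) \<star> (q \<star> (?e' \<star> ?g')) \<approx> one_xpath ?\<sigma>"
    by (rule cat_cancel_middle) (use ge ge_xpaths step q in simp_all)
  moreover have "q \<star> (?e' \<star> ?g') \<in> xpaths X C"
    by (rule xcat_closed) (use ge_xpaths q in simp_all)
  ultimately show ?case
    using ge_xpaths q step by (intro bexI[of _ "q \<star> (?e' \<star> ?g')"]) (simp_all add: xter_xcat)
qed

text \<open>As in a group: if \<open>r\<close> is a right inverse of the right inverse
  \<open>q\<close> of \<open>p\<close>, then \<open>p \<approx> p \<star> (q \<star> r) = (p \<star>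
  q) \<star> r \<approx> r\<close>, so \<open>q\<close> is also a left inverse of
  \<open>p\<close>.\<close>

lemma xpath_inverse_left:
  assumes "p \<in> xpaths X C"
  shows "\<exists>q \<in> xpaths X C. xini q = xter X p \<and> xter X q = xini p \<and> q \<star> p \<approx> one_xpath (xter X p)"
proof -
  obtain q where q: "q \<in> xpaths X C" "xini q = xter X p" "xter X q = xini p"
    "p \<star> q \<approx> one_xpath (xini p)"
    using xpath_inverse_right[OF assms] by auto
  obtain r where r: "r \<in> xpaths X C" "xini r = xter X q" "xter X r = xini q"
    "q \<star> r \<approx> one_xpath (xini q)"
    using xpath_inverse_right[OF q(1)] by auto
  have "p = p \<star> one_xpath (xini q)" using assms q by simp
  also have "\<dots> \<approx> p \<star> (q \<star> r)"
    using assms q r by (intro homotopy_cat_left homotopy_sym[OF r(4)]) auto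
  also have "p \<star> (q \<star> r) = (p \<star> q) \<star> r" using assms q r by (simp add: xcat_assoc)
  also have "\<dots> \<approx> one_xpath (xini p) \<star> r"
    using assms q r by (intro homotopy_cat_right) (auto simp: xter_xcat)
  also have "one_xpath (xini p) \<star> r = r" using q r by simp
  finally have "q \<star> p \<approx> q \<star> r" using q by (intro homotopy_cat_left) auto
  with q r homotopy_trans show ?thesis by metis
qed

lemma hclass_eq_iff:
  "p \<in> xpaths X C \<Longrightarrow> hclass X C p = hclass X C q \<longleftrightarrow> p \<approx> q"
  unfolding hclass_def using homotopy_refl homotopy_sym homotopy_trans by blast

lemma edge_push:
  assumes "a \<in> edges X" "g \<in> carrier (lgrp C (ini X a))"
  shows "vertex_xpath (ini X a) g \<star> edge_xpath X C a
    \<approx> edge_xpath X C a \<star> vertex_xpath (ter X a) (lmap C a g)"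
  using assms homotopy_if_move[OF elem_move.push_fwd[of a X "\<one>\<^bsub>lgrp C (ini X a)\<^esub>" C g
      "\<one>\<^bsub>lgrp C (ter X a)\<^esub>"]]
  by (simp add: vertex_xpath_def edge_xpath_def)

text \<open>The move \<open>compose_fwd\<close> with trivial outer elements, with the twisting
  element split off as a separate path at the end, ready to be absorbed into a class.\<close>

lemma edge_compose:
  assumes "(a, b) \<in> edge_pairs X"
  shows "edge_xpath X C b \<star> edge_xpath X C a
    \<approx> edge_xpath X C (ecomp X a b) \<star> vertex_xpath (ter X a) (inv\<^bsub>lgrp C (ter X a)\<^esub> twist C a b)"
  using assms edge_pairsD[OF assms] twist_closed[OF assms]
    homotopy_if_move[OF elem_move.compose_fwd[of a b X "\<one>\<^bsub>lgrp C (ini X b)\<^esub>" C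
      "\<one>\<^bsub>lgrp C (ter X a)\<^esub>"]]
  by (simp add: vertex_xpath_def edge_xpath_def)

end

section \<open>The development as a scwol\<close>

text \<open>The index set \<open>I\<close> consists of tuples of representatives, \<open>f\<close>
  forms the argument and \<open>g\<close> the value; the last premise is independence of the choice
  of representatives.\<close>

lemma is_map_image:
  assumes "R = (\<lambda>i. (f i, g i)) ` I" "A = f ` I" "g ` I \<subseteq> B"
    and "\<And>i j. i \<in> I \<Longrightarrow> j \<in> I \<Longrightarrow> f i = f j \<Longrightarrow> g i = g j"
  shows "is_map R A B"
  unfolding is_map_def
proof (intro conjI ballI)
  show "R \<subseteq> A \<times> B" using assms(1-3) by auto
  fix x assume "x \<in> A"
  then obtain i where i: "i \<in> I" "x = f i" using assms(2) by blast
  show "\<exists>!y. (x, y) \<in> R"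
  proof (rule ex1I[of _ "g i"])
    show "(x, g i) \<in> R" unfolding assms(1) i(2) using i(1) by (rule imageI)
    fix y assume "(x, y) \<in> R"
    then obtain j where "j \<in> I" "x = f j" "y = g j" unfolding assms(1) by blast
    with i show "y = g i" by (metis assms(4))
  qed
qed

lemma map_of_graph_image:
  assumes R: "R = (\<lambda>i. (f i, g i)) ` I" and "i \<in> I"
    and wd: "\<And>i j. i \<in> I \<Longrightarrow> j \<in> I \<Longrightarrow> f i = f j \<Longrightarrow> g i = g j"
  shows "map_of_graph R (f i) = g i"
  unfolding map_of_graph_def
proof (rule the_equality)
  show "(f i, g i) \<in> R" unfolding R using assms(2) by (rule imageI)
  fix y assume "(f i, y) \<in> R"
  then obtain j where "j \<in> I" "f i = f j" "y = g j" unfolding R by blast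
  with assms(2) show "y = g i" by (metis wd)
qed

locale pointed_complex_of_groups = complex_of_groups X C
  for X :: "('v, 'e) scwol_data" and C :: "('v, 'e, 'g) cog_data" +
  fixes \<sigma>\<^sub>0 :: 'v
  assumes base_vertex [simp]: "\<sigma>\<^sub>0 \<in> vertices X"
begin

abbreviation "paths \<equiv> xpaths_from X C \<sigma>\<^sub>0"

abbreviation "loops \<equiv> xloops X C \<sigma>\<^sub>0"

abbreviation "cls \<equiv> dev_class X C \<sigma>\<^sub>0"

abbreviation "D \<equiv> development X C \<sigma>\<^sub>0"

abbreviation ext :: "('v, 'e, 'g) xpath \<Rightarrow> 'e \<Rightarrow> ('v, 'e, 'g) xpath" (infixl "\<lhd>" 70) where
  "p \<lhd> a \<equiv> p \<star> edge_xpath X C a"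

text \<open>The edge over \<open>a\<close> that starts at the class of \<open>p\<close>. All edges
  of the development arise so, and \<open>p\<close> matters only through its class
  (\<open>dev_edge_eq_iff\<close>).\<close>

definition dev_edge :: "('v, 'e, 'g) xpath \<Rightarrow> 'e \<Rightarrow> ('v, 'e, 'g) dev_edge" where
  "dev_edge p a = (cls p, a, cls (p \<lhd> a))"

lemma paths_iff: "p \<in> paths \<longleftrightarrow> p \<in> xpaths X C \<and> xini p = \<sigma>\<^sub>0"
  by (simp add: xpaths_from_def)

lemma loops_iff: "q \<in> loops \<longleftrightarrow> q \<in> xpaths X C \<and> xini q = \<sigma>\<^sub>0 \<and> xter X q = \<sigma>\<^sub>0"
  by (auto simp: xloops_def xpaths_from_def)

lemma paths_cat [simp]:
  "p \<in> paths \<Longrightarrow> r \<in> xpaths X C \<Longrightarrow> xini r = xter X p \<Longrightarrow> p \<star> r \<in> paths"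
  by (simp add: paths_iff)

lemma xter_ext [simp]: "ini X a = xter X p \<Longrightarrow> xter X (p \<lhd> a) = ter X a"
  by (simp add: xter_xcat)

lemma loops_cat [simp]:
  assumes "q \<in> loops" "p \<in> paths"
  shows "q \<star> p \<in> paths" "xter X (q \<star> p) = xter X p"
  using assms by (auto simp: paths_iff loops_iff xter_xcat)

lemma loops_cat_loops [simp]: "q \<in> loops \<Longrightarrow> q' \<in> loops \<Longrightarrow> q \<star> q' \<in> loops"
  by (auto simp: loops_iff xter_xcat)

lemma one_xpath_loop [simp]: "one_xpath \<sigma>\<^sub>0 \<in> loops"
  by (simp add: loops_iff)

lemma loops_cat_ext:
  assumes "q \<in> loops" "p \<in> paths" "a \<in> edges X" "ini X a = xter X p"
  shows "q \<star> p \<lhd> a = q \<star> (p \<lhd> a)"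
  using assms by (simp add: xcat_assoc paths_iff loops_iff)

section \<open>Classes of paths and their behaviour under concatenation\<close>

lemma dev_rel_iff:
  "p \<in> paths \<Longrightarrow> q \<in> paths \<Longrightarrow> (p, q) \<in> dev_rel X C \<sigma>\<^sub>0 \<longleftrightarrow>
    (\<exists>g\<in>carrier (lgrp C (xter X p)). q \<approx> p \<star> vertex_xpath (xter X p) g)"
  by (simp add: dev_rel_def hclass_eq_iff paths_iff)

lemma vertex_xpath_cancel:
  assumes "p \<approx> r \<star> vertex_xpath \<sigma> g" "r \<in> xpaths X C" "xter X r = \<sigma>"
    "g \<in> carrier (lgrp C \<sigma>)"
  shows "r \<approx> p \<star> vertex_xpath \<sigma> (inv\<^bsub>lgrp C \<sigma>\<^esub> g)"
proof -
  have \<sigma>: "\<sigma> \<in> vertices X" using assms by auto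
  have "r \<star> vertex_xpath \<sigma> g \<star> vertex_xpath \<sigma> (inv\<^bsub>lgrp C \<sigma>\<^esub> g) = r"
    using assms \<sigma> by (simp add: xcat_assoc vertex_xpath_cat)
  moreover have "xter X p = \<sigma>" using homotopy_xpaths[OF assms(1)] assms by (simp add: xter_xcat)
  then have "p \<star> vertex_xpath \<sigma> (inv\<^bsub>lgrp C \<sigma>\<^esub> g)
      \<approx> r \<star> vertex_xpath \<sigma> g \<star> vertex_xpath \<sigma> (inv\<^bsub>lgrp C \<sigma>\<^esub> g)"
    using assms \<sigma> by (intro homotopy_cat_right) auto
  ultimately show ?thesis using homotopy_sym by simp
qed

text \<open>The classes are orbits of right multiplication by the local group at the end vertex.
  Reflexivity, symmetry and transitivity come from its unit, inverses and products.\<close>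

lemma equiv_dev_rel: "equiv paths (dev_rel X C \<sigma>\<^sub>0)"
proof (rule equivI)
  show "dev_rel X C \<sigma>\<^sub>0 \<subseteq> paths \<times> paths" by (auto simp: dev_rel_def)
  show "refl_on paths (dev_rel X C \<sigma>\<^sub>0)"
  proof (rule refl_onI)
    fix p assume "p \<in> paths"
    then show "(p, p) \<in> dev_rel X C \<sigma>\<^sub>0"
      by (auto simp: dev_rel_iff paths_iff homotopy_refl
        intro!: bexI[of _ "\<one>\<^bsub>lgrp C (xter X p)\<^esub>"])
  qed
  show "sym (dev_rel X C \<sigma>\<^sub>0)"
  proof (rule symI)
    fix p q assume pq: "(p, q) \<in> dev_rel X C \<sigma>\<^sub>0"
    then have paths: "p \<in> paths" "q \<in> paths" by (auto simp: dev_rel_def)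
    with pq obtain g where g: "g \<in> carrier (lgrp C (xter X p))"
      "q \<approx> p \<star> vertex_xpath (xter X p) g"
      by (auto simp: dev_rel_iff)
    moreover have "xter X q = xter X p"
      using homotopy_xpaths[OF g(2)] by (simp add: xter_xcat)
    ultimately show "(q, p) \<in> dev_rel X C \<sigma>\<^sub>0"
      using paths vertex_xpath_cancel[OF g(2)]
      by (auto simp: dev_rel_iff paths_iff
        intro!: bexI[of _ "inv\<^bsub>lgrp C (xter X p)\<^esub> g"])
  qed
  show "trans (dev_rel X C \<sigma>\<^sub>0)"
  proof (rule transI)
    fix p q r assume pq: "(p, q) \<in> dev_rel X C \<sigma>\<^sub>0" and qr: "(q, r) \<in> dev_rel X C \<sigma>\<^sub>0"
    then have paths: "p \<in> paths" "q \<in> paths" "r \<in> paths" by (auto simp: dev_rel_def)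
    let ?\<sigma> = "xter X p"
    obtain g where g: "g \<in> carrier (lgrp C ?\<sigma>)" "q \<approx> p \<star> vertex_xpath ?\<sigma> g"
      using pq paths by (auto simp: dev_rel_iff)
    have q: "xter X q = ?\<sigma>"
      using homotopy_xpaths[OF g(2)] by (simp add: xter_xcat)
    obtain h where h: "h \<in> carrier (lgrp C ?\<sigma>)" "r \<approx> q \<star> vertex_xpath ?\<sigma> h"
      using qr paths q by (auto simp: dev_rel_iff)
    note h(2)
    also have "q \<star> vertex_xpath ?\<sigma> h \<approx> p \<star> vertex_xpath ?\<sigma> g \<star> vertex_xpath ?\<sigma> h"
      using g h q paths by (intro homotopy_cat_right) (auto simp: paths_iff)
    also have "p \<star> vertex_xpath ?\<sigma> g \<star> vertex_xpath ?\<sigma> h =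
        p \<star> vertex_xpath ?\<sigma> (g \<otimes>\<^bsub>lgrp C ?\<sigma>\<^esub> h)"
      using g h paths by (simp add: xcat_assoc vertex_xpath_cat paths_iff)
    finally show "(p, r) \<in> dev_rel X C \<sigma>\<^sub>0"
      using g h paths
      by (auto simp: dev_rel_iff paths_iff intro!: bexI[of _ "g \<otimes>\<^bsub>lgrp C ?\<sigma>\<^esub> h"])
  qed
qed

lemma dev_class_eq_iff:
  assumes "p \<in> paths" "q \<in> paths"
  shows "cls p = cls q \<longleftrightarrow>
    (\<exists>g\<in>carrier (lgrp C (xter X p)). q \<approx> p \<star> vertex_xpath (xter X p) g)"
  using eq_equiv_class_iff[OF equiv_dev_rel assms] dev_rel_iff[OF assms]
  by (simp add: dev_class_def)

lemma dev_class_eqI: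
  assumes "p \<in> paths" "xter X p = \<sigma>" "g \<in> carrier (lgrp C \<sigma>)" "q \<approx> p \<star> vertex_xpath \<sigma> g"
  shows "cls p = cls q"
proof -
  have "q \<in> paths" using assms homotopy_xpaths[OF homotopy_sym[OF assms(4)]] by (simp add: paths_iff)
  then show ?thesis using assms dev_class_eq_iff by auto
qed

lemma dev_class_eq_homotopy: "p \<in> paths \<Longrightarrow> p \<approx> q \<Longrightarrow> cls p = cls q"
  using dev_class_eqI[of p "xter X p" "\<one>\<^bsub>lgrp C (xter X p)\<^esub>" q]
  by (simp add: paths_iff homotopy_sym)

text \<open>Makes the projection of the development to \<open>X\<close> well-defined on vertices:
  neither homotopy nor a group element appended at the end moves the end vertex.\<close>

lemma xter_eq_if_dev_class_eq:
  assumes "p \<in> paths" "q \<in> paths" "cls p = cls q"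
  shows "xter X q = xter X p"
  using assms homotopy_xpaths(4) dev_class_eq_iff[of p q] by (fastforce simp: xter_xcat)

lemma dev_class_ext_cong:
  assumes "p \<in> paths" "q \<in> paths" "cls p = cls q" "a \<in> edges X" "ini X a = xter X p"
  shows "cls (p \<lhd> a) = cls (q \<lhd> a)"
proof -
  obtain g where g: "g \<in> carrier (lgrp C (ini X a))" "q \<approx> p \<star> vertex_xpath (ini X a) g"
    using assms dev_class_eq_iff[of p q] by auto
  let ?g = "vertex_xpath (ini X a) g" and ?h = "vertex_xpath (ter X a) (lmap C a g)"
  have q: "xter X q = ini X a" using xter_eq_if_dev_class_eq[OF assms(1-3)] assms(5) by simp
  have "q \<lhd> a \<approx> p \<star> ?g \<lhd> a" using g assms q by (intro homotopy_cat_right) auto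
  also have "p \<star> ?g \<lhd> a = p \<star> (?g \<lhd> a)"
    using g assms by (simp add: xcat_assoc paths_iff)
  also have "\<dots> \<approx> p \<star> (edge_xpath X C a \<star> ?h)"
    using g assms edge_push[of a g] by (intro homotopy_cat_left) (auto simp: paths_iff)
  also have "p \<star> (edge_xpath X C a \<star> ?h) = p \<lhd> a \<star> ?h"
    using g assms by (simp add: xcat_assoc paths_iff)
  finally show ?thesis
    using g assms by (intro dev_class_eqI[of "p \<lhd> a" "ter X a" "lmap C a g"]) simp_all
qed

text \<open>By \<open>edge_compose\<close> the two paths differ by a group element at their end,
  which the class ignores. This gives composites the right terminal vertex and is used again for
  associativity.\<close>

lemma dev_class_ecomp:
  assumes "p \<in> paths" "(a, b) \<in> edge_pairs X" "ini X b = xter X p"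
  shows "cls (p \<lhd> ecomp X a b) = cls (p \<lhd> b \<lhd> a)"
proof -
  note ab = edge_pairsD[OF assms(2)]
  let ?g = "inv\<^bsub>lgrp C (ter X a)\<^esub> twist C a b"
  have g: "?g \<in> carrier (lgrp C (ter X a))" using twist_closed[OF assms(2)] ab by simp
  have "p \<lhd> b \<lhd> a = p \<star> (edge_xpath X C b \<lhd> a)"
    using assms ab by (simp add: xcat_assoc paths_iff)
  also have "\<dots> \<approx> p \<star> (edge_xpath X C (ecomp X a b) \<star> vertex_xpath (ter X a) ?g)"
    using assms ab edge_compose[OF assms(2)]
    by (intro homotopy_cat_left) (auto simp: paths_iff)
  also have "p \<star> (edge_xpath X C (ecomp X a b) \<star> vertex_xpath (ter X a) ?g) =
      p \<lhd> ecomp X a b \<star> vertex_xpath (ter X a) ?g"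
    using assms ab g by (simp add: xcat_assoc paths_iff)
  finally show ?thesis
    using assms ab g by (intro dev_class_eqI[of _ "ter X a" ?g]) simp_all
qed

text \<open>Multiplication on the left leaves untouched the group element \<open>g\<close> that
  relates \<open>p\<close> and \<open>p'\<close> at the right end. Both arguments vary at once,
  since both are given by representatives.\<close>

lemma dev_class_loop_cong:
  assumes "q \<in> loops" "q' \<in> loops" "hclass X C q = hclass X C q'"
    and "p \<in> paths" "p' \<in> paths" "cls p = cls p'"
  shows "cls (q \<star> p) = cls (q' \<star> p')"
proof -
  let ?\<sigma> = "xter X p"
  obtain g where g: "g \<in> carrier (lgrp C ?\<sigma>)" "p' \<approx> p \<star> vertex_xpath ?\<sigma> g"
    using assms dev_class_eq_iff[of p p'] by auto
  have "q' \<star> p' \<approx> q \<star> (p \<star> vertex_xpath ?\<sigma> g)"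
    using assms g hclass_eq_iff[of q q'] homotopy_sym[of q q']
    by (intro homotopy_cat) (auto simp: paths_iff loops_iff)
  also have "q \<star> (p \<star> vertex_xpath ?\<sigma> g) = q \<star> p \<star> vertex_xpath ?\<sigma> g"
    using assms g by (simp add: xcat_assoc paths_iff loops_iff)
  finally show ?thesis
    using assms g by (intro dev_class_eqI[of _ ?\<sigma> g]) simp_all
qed

lemma dev_edge_eq_iff:
  assumes "p \<in> paths" "q \<in> paths" "a \<in> edges X" "ini X a = xter X p"
  shows "dev_edge p a = dev_edge q b \<longleftrightarrow> cls p = cls q \<and> a = b"
  using dev_class_ext_cong[OF assms(1,2) _ assms(3,4)] by (auto simp: dev_edge_def)

lemma development_simps [simp]:
  "vertices D = cls ` paths"
  "edges D = {dev_edge p a | p a. p \<in> paths \<and> a \<in> edges X \<and> ini X a = xter X p}"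
  "ini D (dev_edge p a) = cls p"
  "ter D (dev_edge p a) = cls (p \<lhd> a)"
  by (auto simp: development_def dev_vertices_def dev_edges_def dev_edge_def)

lemma dev_edge_closed:
  "p \<in> paths \<Longrightarrow> a \<in> edges X \<Longrightarrow> ini X a = xter X p \<Longrightarrow> dev_edge p a \<in> edges D"
  by auto

text \<open>The given \<open>p\<close> can serve as the representative, not merely some path
  equivalent to it. Adjacent edges can thus be described over one path, and stars are parametrised
  by the edges of \<open>X\<close> at \<open>xter X p\<close>.\<close>

lemma star_cases:
  assumes "x \<in> edges D" "ini D x = cls p" "p \<in> paths"
  obtains a where "x = dev_edge p a" "a \<in> edges X" "ini X a = xter X p"
proof -
  obtain p' a where x: "x = dev_edge p' a" "p' \<in> paths" "a \<in> edges X" "ini X a = xter X p'"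
    using assms by auto
  then have "cls p' = cls p" using assms by simp
  then show ?thesis
    using that[of a] x assms xter_eq_if_dev_class_eq[of p' p] by (simp add: dev_edge_eq_iff)
qed

section \<open>Composition of edges\<close>

definition pair_index :: "(('v, 'e, 'g) xpath \<times> 'e \<times> 'e) set" where
  "pair_index = {(p, a, b). p \<in> paths \<and> (a, b) \<in> edge_pairs X \<and> ini X b = xter X p}"

lemma edge_pairs_development:
  "edge_pairs D = (\<lambda>(p, a, b). (dev_edge (p \<lhd> b) a, dev_edge p b)) ` pair_index"
proof (intro equalityI subsetI)
  fix z assume z: "z \<in> edge_pairs D"
  then obtain x y where xy: "z = (x, y)" "x \<in> edges D" "y \<in> edges D" "ini D x = ter D y"
    by (auto simp: edge_pairs_def simp del: development_simps)
  then obtain p b where y: "y = dev_edge p b" "p \<in> paths" "b \<in> edges X" "ini X b = xter X p"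
    by auto
  \<comment> \<open>Since \<open>x\<close> starts where \<open>y\<close> ends, it can be represented
    over the path \<open>p \<lhd> b\<close> that represents this vertex.\<close>
  moreover obtain a where "x = dev_edge (p \<lhd> b) a" "a \<in> edges X" "ini X a = ter X b"
    using star_cases[of x "p \<lhd> b"] xy y by auto
  ultimately show "z \<in> (\<lambda>(p, a, b). (dev_edge (p \<lhd> b) a, dev_edge p b)) ` pair_index"
    using xy by (intro image_eqI[of _ _ "(p, a, b)"]) (auto simp: pair_index_def edge_pairs_def)
next
  fix z assume "z \<in> (\<lambda>(p, a, b). (dev_edge (p \<lhd> b) a, dev_edge p b)) ` pair_index"
  then obtain p a b where z: "z = (dev_edge (p \<lhd> b) a, dev_edge p b)"
    and p: "p \<in> paths" "(a, b) \<in> edge_pairs X" "ini X b = xter X p"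
    by (auto simp: pair_index_def)
  with edge_pairsD[OF p(2)] have "dev_edge (p \<lhd> b) a \<in> edges D" "dev_edge p b \<in> edges D"
    by (auto intro!: dev_edge_closed simp del: development_simps(2))
  with z show "z \<in> edge_pairs D" by (simp add: edge_pairs_def)
qed

lemma dev_comp_graph_eq:
  "dev_comp_graph X C \<sigma>\<^sub>0 =
    (\<lambda>i. ((\<lambda>(p, a, b). (dev_edge (p \<lhd> b) a, dev_edge p b)) i,
      (\<lambda>(p, a, b). dev_edge p (ecomp X a b)) i)) ` pair_index"
proof -
  \<comment> \<open>An equality of paths, not only a homotopy: the adjoining unit elements multiply
    to the unit.\<close>
  have "p \<star> edge2_xpath X C b a = p \<lhd> b \<lhd> a"
    if "p \<in> paths" "(a, b) \<in> edge_pairs X" "ini X b = xter X p" for p a b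
    using that edge_pairsD[of a b] by (simp add: edge2_xpath_eq xcat_assoc paths_iff)
  then show ?thesis
    by (force simp: dev_comp_graph_def pair_index_def dev_edge_def image_iff)
qed

text \<open>The edges of \<open>X\<close> can be read off the triples, so two indices of the same
  pair differ only in the representative \<open>p\<close>, and \<open>dev_edge\<close> sees just its
  class.\<close>

lemma dev_comp_well_defined:
  assumes "i \<in> pair_index" "j \<in> pair_index"
    and "(\<lambda>(p, a, b). (dev_edge (p \<lhd> b) a, dev_edge p b)) i =
      (\<lambda>(p, a, b). (dev_edge (p \<lhd> b) a, dev_edge p b)) j"
  shows "(\<lambda>(p, a, b). dev_edge p (ecomp X a b)) i = (\<lambda>(p, a, b). dev_edge p (ecomp X a b)) j"
proof -
  obtain p a b where i: "i = (p, a, b)" by (cases i)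
  obtain p' a' b' where j: "j = (p', a', b')" by (cases j)
  have p: "p \<in> paths" "(a, b) \<in> edge_pairs X" "ini X b = xter X p"
    and p': "p' \<in> paths" using assms i j by (auto simp: pair_index_def)
  have "a = a'" "b = b'" "cls p = cls p'" using assms(3) i j by (auto simp: dev_edge_def)
  then show ?thesis using p p' i j edge_pairsD[OF p(2)] by (simp add: dev_edge_eq_iff)
qed

lemma is_map_dev_comp: "is_map (dev_comp_graph X C \<sigma>\<^sub>0) (edge_pairs D) (edges D)"
  by (rule is_map_image[OF dev_comp_graph_eq edge_pairs_development _ dev_comp_well_defined])
    (auto simp: pair_index_def edge_pairsD(4-6) simp del: development_simps(2) intro!: dev_edge_closed)

lemma ecomp_dev_edge:
  assumes "p \<in> paths" "(a, b) \<in> edge_pairs X" "ini X b = xter X p"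
  shows "ecomp D (dev_edge (p \<lhd> b) a) (dev_edge p b) = dev_edge p (ecomp X a b)"
proof -
  have "(p, a, b) \<in> pair_index" using assms by (simp add: pair_index_def)
  from map_of_graph_image[OF dev_comp_graph_eq this dev_comp_well_defined]
  have "map_of_graph (dev_comp_graph X C \<sigma>\<^sub>0) (dev_edge (p \<lhd> b) a, dev_edge p b) =
      dev_edge p (ecomp X a b)"
    unfolding prod.case .
  then show ?thesis by (simp add: development_def)
qed

lemma edge_pairs_cases:
  assumes "(x, y) \<in> edge_pairs D"
  obtains p a b where "x = dev_edge (p \<lhd> b) a" "y = dev_edge p b"
    "p \<in> paths" "(a, b) \<in> edge_pairs X" "ini X b = xter X p"
  using assms that by (auto simp: edge_pairs_development pair_index_def)

lemma scwol_development: "scwol D"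
proof
  fix x assume "x \<in> edges D"
  then obtain p a where x: "x = dev_edge p a" "p \<in> paths" "a \<in> edges X" "ini X a = xter X p"
    by auto
  show "ini D x \<in> vertices D" "ter D x \<in> vertices D" using x by auto
  show "ini D x \<noteq> ter D x"
    using x no_loops[of a] xter_eq_if_dev_class_eq[of p "p \<lhd> a"] by auto
next
  fix x y assume "(x, y) \<in> edge_pairs D"
  then obtain p a b where xy: "x = dev_edge (p \<lhd> b) a" "y = dev_edge p b"
    and p: "p \<in> paths" "(a, b) \<in> edge_pairs X" "ini X b = xter X p"
    by (rule edge_pairs_cases)
  note comp = ecomp_dev_edge[OF p] and ab = edge_pairsD[OF p(2)]
  show "ecomp D x y \<in> edges D"
    unfolding xy comp using p ab by (intro dev_edge_closed) auto
  show "ini D (ecomp D x y) = ini D y" "ter D (ecomp D x y) = ter D x"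
    unfolding xy comp using p dev_class_ecomp[OF p] by auto
next
  fix x y z assume "(x, y, z) \<in> edge_triples D"
  then have xy: "(x, y) \<in> edge_pairs D" and yz: "(y, z) \<in> edge_pairs D"
    by (auto simp: edge_triples_def)
  from yz obtain p b c where y: "y = dev_edge (p \<lhd> c) b" and z: "z = dev_edge p c"
    and p: "p \<in> paths" "(b, c) \<in> edge_pairs X" "ini X c = xter X p"
    by (rule edge_pairs_cases)
  note bc = edge_pairsD[OF p(2)]
  from xy y have x': "x \<in> edges D" "ini D x = cls (p \<lhd> c \<lhd> b)"
    by (auto simp: edge_pairs_def simp del: development_simps(2))
  \<comment> \<open>With this representative all three edges are described by the single path
    \<open>p\<close> and the edges \<open>c\<close>, \<open>b\<close>, \<open>a\<close> of
    \<open>X\<close>.\<close>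
  obtain a where x: "x = dev_edge (p \<lhd> c \<lhd> b) a" "a \<in> edges X" "ini X a = ter X b"
    using star_cases[OF x'] p bc by auto
  have ab: "(a, b) \<in> edge_pairs X" using x bc by (simp add: edge_pairs_def)
  note ab' = edge_pairsD[OF ab]
  have ab_c: "(ecomp X a b, c) \<in> edge_pairs X" "(a, ecomp X b c) \<in> edge_pairs X"
    using ab' bc by (auto simp: edge_pairs_def)
  \<comment> \<open>To compose \<open>x\<close> with the composite of \<open>y\<close> and
    \<open>z\<close>, the rule \<open>ecomp_dev_edge\<close> needs \<open>x\<close> over the
    extension of \<open>p\<close> by \<open>ecomp X b c\<close>; that path has the same class as
    \<open>p \<lhd> c \<lhd> b\<close>.\<close>
  have "x = dev_edge (p \<lhd> ecomp X b c) a"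
    using p x bc dev_class_ecomp[OF p] by (simp add: dev_edge_eq_iff)
  then have "ecomp D x (ecomp D y z) = dev_edge p (ecomp X a (ecomp X b c))"
    using y z p bc ab_c by (simp add: ecomp_dev_edge)
  moreover have "ecomp D (ecomp D x y) z = dev_edge p (ecomp X (ecomp X a b) c)"
    using x y z p ab bc ab_c by (simp add: ecomp_dev_edge)
  ultimately show "ecomp D (ecomp D x y) z = ecomp D x (ecomp D y z)"
    using ecomp_assoc[of a b c] ab p by (simp add: edge_triples_def)
qed

section \<open>Connectedness of the development\<close>

lemma edge_path_dev_edge:
  assumes "p \<in> paths" "a \<in> edges X" "ini X a = xter X p"
  shows "edge_path D (cls p) [Fwd (dev_edge p a)] (cls (p \<lhd> a))"
    and "edge_path D (cls (p \<lhd> a)) [Bwd (dev_edge p a)] (cls p)"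
  using dev_edge_closed[OF assms] by (simp_all del: development_simps(2))

text \<open>The starting path \<open>r\<close> is arbitrary because the induction on \<open>p\<close> splits off its first step, which
  is then absorbed into \<open>r\<close>.\<close>

lemma edge_path_dev_cat:
  assumes "p \<in> xpaths X C" "r \<in> paths" "xter X r = xini p"
  shows "\<exists>es. edge_path D (cls r) es (cls (r \<star> p))"
  using assms
proof (induction arbitrary: r rule: xpath_generator_induct)
  case (vertex \<sigma> g)
  then have "cls r = cls (r \<star> vertex_xpath \<sigma> g)"
    by (intro dev_class_eqI[of _ \<sigma> g]) (auto simp: paths_iff intro: homotopy_refl)
  then show ?case by (intro exI[of _ "[]"]) simp
next
  case (step g e p)
  let ?g = "vertex_xpath (oini X e) g" and ?e = "oedge_xpath e"
  have r: "r \<in> xpaths X C" "xter X r = oini X e" using step.prems by (auto simp: paths_iff)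
  have rg: "r \<star> ?g \<in> paths" "xter X (r \<star> ?g) = oini X e"
    using step r by (auto simp: xter_xcat)
  have rge: "r \<star> ?g \<star> ?e \<in> paths" "xter X (r \<star> ?g \<star> ?e) = oter X e"
    using step rg by (auto simp: xter_xcat)
  have "cls r = cls (r \<star> ?g)"
  proof (rule dev_class_eqI[OF step.prems(1) r(2) step(2)])
    have "r \<star> ?g \<in> xpaths X C" using rg(1) by (simp add: paths_iff)
    then show "r \<star> ?g \<approx> r \<star> ?g" by (rule homotopy_refl)
  qed
  moreover have "\<exists>es. edge_path D (cls (r \<star> ?g)) es (cls (r \<star> ?g \<star> ?e))"
  proof (cases e)
    case (Fwd a)
    then have "a \<in> edges X" "ini X a = xter X (r \<star> ?g)" using step(1) rg(2) by simp_all
    from edge_path_dev_edge(1)[OF rg(1) this] Fwd show ?thesis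
      unfolding edge_xpath_eq by blast
  next
    case (Bwd a)
    \<comment> \<open>Following \<open>a\<close> backwards and then extending by \<open>a\<close>
      cancels. So the edge over \<open>a\<close> at the class of the longer path ends at the class
      of the shorter one, and is traversed in reverse.\<close>
    have "r \<star> ?g \<star> ?e \<lhd> a = r \<star> ?g \<star> (?e \<star> oedge_xpath (oinv e))"
      using Bwd step(1) rg by (simp add: xcat_assoc paths_iff edge_xpath_eq)
    also have "\<dots> \<approx> r \<star> ?g \<star> one_xpath (oini X e)"
      using step(1) rg oedge_xpath_inverse
      by (intro homotopy_cat_left) (auto simp: paths_iff)
    also have "r \<star> ?g \<star> one_xpath (oini X e) = r \<star> ?g" using rg by (simp add: paths_iff)
    finally have "cls (r \<star> ?g \<star> ?e \<lhd> a) = cls (r \<star> ?g)"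
      using rg dev_class_eq_homotopy homotopy_sym by metis
    moreover have "a \<in> edges X" "ini X a = xter X (r \<star> ?g \<star> ?e)"
      using Bwd step(1) rge(2) by simp_all
    ultimately show ?thesis using edge_path_dev_edge(2)[OF rge(1)] by metis
  qed
  moreover have "\<exists>es. edge_path D (cls (r \<star> ?g \<star> ?e)) es (cls (r \<star> ?g \<star> ?e \<star> p))"
    using step.IH[of "r \<star> ?g \<star> ?e"] step rge by simp
  moreover have "r \<star> ?g \<star> ?e \<star> p = r \<star> (?g \<star> ?e \<star> p)"
    using step r by (simp add: xcat_assoc xter_xcat)
  ultimately show ?case using edge_path_append by metis
qed

text \<open>A vertex \<open>cls p\<close> is joined to the class of the trivial path by lifting
  \<open>p\<close> itself, because \<open>one_xpath \<sigma>\<^sub>0 \<star> p = p\<close>.\<close>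

lemma connected_development: "scwol_connected D"
proof -
  have from_base: "\<exists>es. edge_path D (cls (one_xpath \<sigma>\<^sub>0)) es v" if v: "v \<in> vertices D" for v
  proof -
    obtain p where "v = cls p" "p \<in> paths" using v by auto
    then show ?thesis
      using edge_path_dev_cat[of p "one_xpath \<sigma>\<^sub>0"] by (simp add: paths_iff)
  qed
  show ?thesis
    unfolding scwol_connected_def
  proof (intro ballI)
    fix v w assume "v \<in> vertices D" "w \<in> vertices D"
    then show "\<exists>es. edge_path D v es w"
      using from_base edge_path_reverse edge_path_append by metis
  qed
qed

section \<open>The action of the fundamental group\<close>

abbreviation "pi1 \<equiv> cog_pi1 X C \<sigma>\<^sub>0"

lemma carrier_pi1: "carrier pi1 = hclass X C ` loops"
  by (auto simp: cog_pi1_def)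

lemma one_pi1: "\<one>\<^bsub>pi1\<^esub> = hclass X C (one_xpath \<sigma>\<^sub>0)"
  by (simp add: cog_pi1_def)

lemma hclass_eqI: "p \<approx> q \<Longrightarrow> hclass X C p = hclass X C q"
  using hclass_eq_iff homotopy_xpaths(1) by blast

text \<open>The product is a union over all pairs of representatives. Its members coincide because
  homotopy is a congruence, and the union is not empty.\<close>

lemma mult_pi1:
  assumes "q \<in> loops" "q' \<in> loops"
  shows "hclass X C q \<otimes>\<^bsub>pi1\<^esub> hclass X C q' = hclass X C (q \<star> q')"
proof -
  let ?A = "hclass X C q" and ?B = "hclass X C q'"
  have mem: "q \<in> ?A" "q' \<in> ?B"
    using assms by (simp_all add: hclass_def loops_iff homotopy_refl)
  have "hclass X C (r \<star> r') = hclass X C (q \<star> q')" if "r \<in> ?A" "r' \<in> ?B" for r r'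
    using homotopy_cat[of q r q' r'] that assms hclass_eqI[of "q \<star> q'" "r \<star> r'"]
    by (simp add: hclass_def loops_iff)
  then have "(\<Union>r\<in>?A. \<Union>r'\<in>?B. hclass X C (r \<star> r')) = (\<Union>r\<in>?A. \<Union>r'\<in>?B. hclass X C (q \<star> q'))"
    by (intro SUP_cong refl)
  also have "\<dots> = hclass X C (q \<star> q')" using mem by blast
  finally show ?thesis by (simp add: cog_pi1_def)
qed

lemma group_pi1: "group pi1"
proof (rule groupI)
  fix x y assume "x \<in> carrier pi1" "y \<in> carrier pi1"
  then obtain q r where "x = hclass X C q" "q \<in> loops" "y = hclass X C r" "r \<in> loops"
    unfolding carrier_pi1 by blast
  then show "x \<otimes>\<^bsub>pi1\<^esub> y \<in> carrier pi1" by (simp add: mult_pi1 carrier_pi1)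
next
  show "\<one>\<^bsub>pi1\<^esub> \<in> carrier pi1" by (simp add: one_pi1 carrier_pi1)
next
  fix x y z assume "x \<in> carrier pi1" "y \<in> carrier pi1" "z \<in> carrier pi1"
  then obtain q r s where x: "x = hclass X C q" "y = hclass X C r" "z = hclass X C s"
    and l: "q \<in> loops" "r \<in> loops" "s \<in> loops"
    unfolding carrier_pi1 by blast
  have "q \<star> r \<star> s = q \<star> (r \<star> s)" using l by (simp add: xcat_assoc loops_iff)
  with x l show "x \<otimes>\<^bsub>pi1\<^esub> y \<otimes>\<^bsub>pi1\<^esub> z = x \<otimes>\<^bsub>pi1\<^esub> (y \<otimes>\<^bsub>pi1\<^esub> z)" by (simp add: mult_pi1)
next
  fix x assume "x \<in> carrier pi1"
  then obtain q where x: "x = hclass X C q" and q: "q \<in> loops"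
    unfolding carrier_pi1 by blast
  have "one_xpath \<sigma>\<^sub>0 \<star> q = q" using q by (simp add: loops_iff)
  with x q show "\<one>\<^bsub>pi1\<^esub> \<otimes>\<^bsub>pi1\<^esub> x = x" by (simp add: mult_pi1 one_pi1)
  \<comment> \<open>\<open>groupI\<close> asks for left inverses; the end points of \<open>r\<close>
    make it a loop.\<close>
  obtain r where r: "r \<in> loops" "r \<star> q \<approx> one_xpath \<sigma>\<^sub>0"
    using xpath_inverse_left[of q] q by (auto simp: loops_iff)
  then show "\<exists>y\<in>carrier pi1. y \<otimes>\<^bsub>pi1\<^esub> x = \<one>\<^bsub>pi1\<^esub>"
    using x q hclass_eqI[OF r(2)]
    by (intro bexI[of _ "hclass X C r"]) (simp_all add: mult_pi1 one_pi1 carrier_pi1)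
qed

section \<open>Left concatenation as a map on vertices and edges\<close>

lemma dev_vertex_act_graph_eq:
  "dev_vertex_act_graph X C \<sigma>\<^sub>0 =
    (\<lambda>i. ((\<lambda>(q, p). (hclass X C q, cls p)) i, (\<lambda>(q, p). cls (q \<star> p)) i)) ` (loops \<times> paths)"
  by (force simp: dev_vertex_act_graph_def image_iff)

lemma dev_vertex_act_well_defined:
  assumes "i \<in> loops \<times> paths" "j \<in> loops \<times> paths"
    and "(\<lambda>(q, p). (hclass X C q, cls p)) i = (\<lambda>(q, p). (hclass X C q, cls p)) j"
  shows "(\<lambda>(q, p). cls (q \<star> p)) i = (\<lambda>(q, p). cls (q \<star> p)) j"
proof -
  obtain q p where i: "i = (q, p)" by (cases i)
  obtain q' p' where j: "j = (q', p')" by (cases j)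
  show ?thesis using assms i j dev_class_loop_cong[of q q' p p'] by simp
qed

lemma is_map_dev_vertex_act:
  "is_map (dev_vertex_act_graph X C \<sigma>\<^sub>0) (carrier pi1 \<times> vertices D) (vertices D)"
proof (rule is_map_image[OF dev_vertex_act_graph_eq _ _ dev_vertex_act_well_defined])
  show "carrier pi1 \<times> vertices D = (\<lambda>(q, p). (hclass X C q, cls p)) ` (loops \<times> paths)"
    by (force simp: carrier_pi1 image_iff)
  show "(\<lambda>(q, p). cls (q \<star> p)) ` (loops \<times> paths) \<subseteq> vertices D" by auto
qed

definition edge_act_index :: "(('v, 'e, 'g) xpath \<times> ('v, 'e, 'g) xpath \<times> 'e) set" where
  "edge_act_index = {(q, p, a). q \<in> loops \<and> p \<in> paths \<and> a \<in> edges X \<and> ini X a = xter X p}"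

lemma dev_edge_act_graph_eq:
  "dev_edge_act_graph X C \<sigma>\<^sub>0 =
    (\<lambda>i. ((\<lambda>(q, p, a). (hclass X C q, dev_edge p a)) i,
      (\<lambda>(q, p, a). dev_edge (q \<star> p) a) i)) ` edge_act_index"
  by (force simp: dev_edge_act_graph_def edge_act_index_def dev_edge_def image_iff)

lemma dev_edge_act_well_defined:
  assumes "i \<in> edge_act_index" "j \<in> edge_act_index"
    and "(\<lambda>(q, p, a). (hclass X C q, dev_edge p a)) i =
      (\<lambda>(q, p, a). (hclass X C q, dev_edge p a)) j"
  shows "(\<lambda>(q, p, a). dev_edge (q \<star> p) a) i = (\<lambda>(q, p, a). dev_edge (q \<star> p) a) j"
proof -
  obtain q p a where i: "i = (q, p, a)" by (cases i)
  obtain q' p' a' where j: "j = (q', p', a')" by (cases j)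
  have q: "q \<in> loops" "q' \<in> loops" "hclass X C q = hclass X C q'"
    and p: "p \<in> paths" "p' \<in> paths" "a \<in> edges X" "ini X a = xter X p"
    using assms i j by (simp_all add: edge_act_index_def)
  have "cls p = cls p'" "a = a'" using assms(3) i j p by (simp_all add: dev_edge_eq_iff)
  then show ?thesis
    using i j p q dev_class_loop_cong[OF q p(1,2)] by (simp add: dev_edge_eq_iff)
qed

lemma is_map_dev_edge_act:
  "is_map (dev_edge_act_graph X C \<sigma>\<^sub>0) (carrier pi1 \<times> edges D) (edges D)"
proof (rule is_map_image[OF dev_edge_act_graph_eq _ _ dev_edge_act_well_defined])
  show "carrier pi1 \<times> edges D = (\<lambda>(q, p, a). (hclass X C q, dev_edge p a)) ` edge_act_index"
    by (force simp: carrier_pi1 image_iff edge_act_index_def)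
  show "(\<lambda>(q, p, a). dev_edge (q \<star> p) a) ` edge_act_index \<subseteq> edges D"
    by (auto simp: edge_act_index_def simp del: development_simps(2) intro!: dev_edge_closed)
qed

lemma dev_act_vertex:
  assumes "q \<in> loops" "p \<in> paths"
  shows "fst (dev_act X C \<sigma>\<^sub>0 (hclass X C q)) (cls p) = cls (q \<star> p)"
proof -
  have "(q, p) \<in> loops \<times> paths" using assms by simp
  from map_of_graph_image[OF dev_vertex_act_graph_eq this dev_vertex_act_well_defined]
  have "map_of_graph (dev_vertex_act_graph X C \<sigma>\<^sub>0) (hclass X C q, cls p) = cls (q \<star> p)"
    unfolding prod.case .
  moreover have "cls p \<in> dev_vertices X C \<sigma>\<^sub>0" using assms by (auto simp: dev_vertices_def)
  ultimately show ?thesis by (simp add: dev_act_def)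
qed

lemma dev_act_edge:
  assumes "q \<in> loops" "p \<in> paths" "a \<in> edges X" "ini X a = xter X p"
  shows "snd (dev_act X C \<sigma>\<^sub>0 (hclass X C q)) (dev_edge p a) = dev_edge (q \<star> p) a"
proof -
  have "(q, p, a) \<in> edge_act_index" using assms by (simp add: edge_act_index_def)
  from map_of_graph_image[OF dev_edge_act_graph_eq this dev_edge_act_well_defined]
  have "map_of_graph (dev_edge_act_graph X C \<sigma>\<^sub>0) (hclass X C q, dev_edge p a) =
      dev_edge (q \<star> p) a"
    unfolding prod.case .
  moreover have "dev_edge p a \<in> dev_edges X C \<sigma>\<^sub>0"
    using assms by (auto simp: dev_edges_def dev_edge_def)
  ultimately show ?thesis by (simp add: dev_act_def)
qed

text \<open>Elements of \<open>scwol_Aut\<close> are compared as functions, so the values outside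
  the vertices and edges have to be fixed as well.\<close>

lemma dev_act_extensional:
  "fst (dev_act X C \<sigma>\<^sub>0 h) \<in> extensional (vertices D)"
  "snd (dev_act X C \<sigma>\<^sub>0 h) \<in> extensional (edges D)"
  by (simp_all add: dev_act_def development_def)

lemma dev_act_one:
  "v \<in> vertices D \<Longrightarrow> fst (dev_act X C \<sigma>\<^sub>0 \<one>\<^bsub>pi1\<^esub>) v = v"
  "x \<in> edges D \<Longrightarrow> snd (dev_act X C \<sigma>\<^sub>0 \<one>\<^bsub>pi1\<^esub>) x = x"
proof -
  have one: "one_xpath \<sigma>\<^sub>0 \<star> p = p" if "p \<in> paths" for p
    using that by (simp add: paths_iff)
  show "fst (dev_act X C \<sigma>\<^sub>0 \<one>\<^bsub>pi1\<^esub>) v = v" if "v \<in> vertices D"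
    using that by (auto simp: one_pi1 dev_act_vertex one)
  show "snd (dev_act X C \<sigma>\<^sub>0 \<one>\<^bsub>pi1\<^esub>) x = x" if "x \<in> edges D"
    using that by (auto simp: one_pi1 dev_act_edge one)
qed

lemma dev_act_mult:
  assumes "h \<in> carrier pi1" "h' \<in> carrier pi1"
  shows "v \<in> vertices D \<Longrightarrow> fst (dev_act X C \<sigma>\<^sub>0 (h \<otimes>\<^bsub>pi1\<^esub> h')) v =
      fst (dev_act X C \<sigma>\<^sub>0 h) (fst (dev_act X C \<sigma>\<^sub>0 h') v)"
    and "x \<in> edges D \<Longrightarrow> snd (dev_act X C \<sigma>\<^sub>0 (h \<otimes>\<^bsub>pi1\<^esub> h')) x =
      snd (dev_act X C \<sigma>\<^sub>0 h) (snd (dev_act X C \<sigma>\<^sub>0 h') x)"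
proof -
  obtain q q' where h: "h = hclass X C q" "h' = hclass X C q'"
    and q: "q \<in> loops" "q' \<in> loops"
    using assms unfolding carrier_pi1 by blast
  have assoc: "q \<star> q' \<star> p = q \<star> (q' \<star> p)" if "p \<in> paths" for p
    using that q by (simp add: xcat_assoc loops_iff paths_iff)
  show "fst (dev_act X C \<sigma>\<^sub>0 (h \<otimes>\<^bsub>pi1\<^esub> h')) v =
      fst (dev_act X C \<sigma>\<^sub>0 h) (fst (dev_act X C \<sigma>\<^sub>0 h') v)" if "v \<in> vertices D"
    using that h q by (auto simp: mult_pi1 dev_act_vertex assoc)
  show "snd (dev_act X C \<sigma>\<^sub>0 (h \<otimes>\<^bsub>pi1\<^esub> h')) x =
      snd (dev_act X C \<sigma>\<^sub>0 h) (snd (dev_act X C \<sigma>\<^sub>0 h') x)" if "x \<in> edges D"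
    using that h q by (auto simp: mult_pi1 dev_act_edge assoc)
qed

lemma dev_act_closed:
  assumes "h \<in> carrier pi1"
  shows "v \<in> vertices D \<Longrightarrow> fst (dev_act X C \<sigma>\<^sub>0 h) v \<in> vertices D"
    and "x \<in> edges D \<Longrightarrow> snd (dev_act X C \<sigma>\<^sub>0 h) x \<in> edges D"
proof -
  obtain q where h: "h = hclass X C q" "q \<in> loops"
    using assms unfolding carrier_pi1 by blast
  show "fst (dev_act X C \<sigma>\<^sub>0 h) v \<in> vertices D" if "v \<in> vertices D"
    using that h by (auto simp: dev_act_vertex)
  show "snd (dev_act X C \<sigma>\<^sub>0 h) x \<in> edges D" if x: "x \<in> edges D"
  proof -
    obtain p a where "x = dev_edge p a" "p \<in> paths" "a \<in> edges X" "ini X a = xter X p"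
      using x by auto
    then show ?thesis
      using h dev_edge_closed[of "q \<star> p" a] by (simp add: dev_act_edge del: development_simps(2))
  qed
qed

lemma dev_act_Bij:
  assumes h: "h \<in> carrier pi1"
  shows "fst (dev_act X C \<sigma>\<^sub>0 h) \<in> Bij (vertices D)"
    and "snd (dev_act X C \<sigma>\<^sub>0 h) \<in> Bij (edges D)"
proof -
  interpret group pi1 by (rule group_pi1)
  let ?h = "inv\<^bsub>pi1\<^esub> h"
  have inv: "?h \<in> carrier pi1" "h \<otimes>\<^bsub>pi1\<^esub> ?h = \<one>\<^bsub>pi1\<^esub>" "?h \<otimes>\<^bsub>pi1\<^esub> h = \<one>\<^bsub>pi1\<^esub>"
    using h by simp_all
  \<comment> \<open>The inverse map is the action of the inverse group element.\<close>
  have "bij_betw (fst (dev_act X C \<sigma>\<^sub>0 h)) (vertices D) (vertices D)"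
    by (rule bij_betw_byWitness[where f' = "fst (dev_act X C \<sigma>\<^sub>0 ?h)"])
      (use inv dev_act_mult(1)[OF h inv(1)] dev_act_mult(1)[OF inv(1) h] dev_act_one(1)
        dev_act_closed(1)[OF h] dev_act_closed(1)[OF inv(1)]
       in \<open>auto simp del: development_simps\<close>)
  then show "fst (dev_act X C \<sigma>\<^sub>0 h) \<in> Bij (vertices D)"
    using dev_act_extensional(1) by (simp add: Bij_def)
  have "bij_betw (snd (dev_act X C \<sigma>\<^sub>0 h)) (edges D) (edges D)"
    by (rule bij_betw_byWitness[where f' = "snd (dev_act X C \<sigma>\<^sub>0 ?h)"])
      (use inv dev_act_mult(2)[OF h inv(1)] dev_act_mult(2)[OF inv(1) h] dev_act_one(2)
        dev_act_closed(2)[OF h] dev_act_closed(2)[OF inv(1)]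
       in \<open>auto simp del: development_simps\<close>)
  then show "snd (dev_act X C \<sigma>\<^sub>0 h) \<in> Bij (edges D)"
    using dev_act_extensional(2) by (simp add: Bij_def)
qed

lemma dev_act_morphism:
  assumes h: "h \<in> carrier pi1"
  shows "scwol_morphism D D (fst (dev_act X C \<sigma>\<^sub>0 h)) (snd (dev_act X C \<sigma>\<^sub>0 h))"
proof -
  let ?f = "fst (dev_act X C \<sigma>\<^sub>0 h)" and ?g = "snd (dev_act X C \<sigma>\<^sub>0 h)"
  obtain q where q: "h = hclass X C q" "q \<in> loops"
    using h unfolding carrier_pi1 by blast
  have f: "?f (cls p) = cls (q \<star> p)" if "p \<in> paths" for p
    using that q dev_act_vertex by simp
  have g: "?g (dev_edge p a) = dev_edge (q \<star> p) a"
    if "p \<in> paths" "a \<in> edges X" "ini X a = xter X p" for p a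
    using that q dev_act_edge by simp
  have ini_ter: "ini D (?g x) = ?f (ini D x) \<and> ter D (?g x) = ?f (ter D x)"
    if x: "x \<in> edges D" for x
  proof -
    obtain p a where "x = dev_edge p a" "p \<in> paths" "a \<in> edges X" "ini X a = xter X p"
      using x by auto
    then show ?thesis using q(2) by (simp add: f g loops_cat_ext)
  qed
  have comp: "?g (ecomp D x y) = ecomp D (?g x) (?g y)" if "(x, y) \<in> edge_pairs D" for x y
  proof -
    obtain p a b where xy: "x = dev_edge (p \<lhd> b) a" "y = dev_edge p b"
      and p: "p \<in> paths" "(a, b) \<in> edge_pairs X" "ini X b = xter X p"
      using \<open>(x, y) \<in> edge_pairs D\<close> by (rule edge_pairs_cases)
    note ab = edge_pairsD[OF p(2)]
    have "?g (ecomp D x y) = dev_edge (q \<star> p) (ecomp X a b)"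
      unfolding xy ecomp_dev_edge[OF p] using p ab by (simp add: g)
    also have "\<dots> = ecomp D (dev_edge (q \<star> p \<lhd> b) a) (dev_edge (q \<star> p) b)"
      using p q(2) by (simp add: ecomp_dev_edge)
    also have "\<dots> = ecomp D (?g x) (?g y)"
      using p q(2) ab xy by (simp add: g loops_cat_ext)
    finally show ?thesis .
  qed
  have star: "bij_betw ?g {x \<in> edges D. ini D x = v} {y \<in> edges D. ini D y = ?f v}"
    if v: "v \<in> vertices D" for v
  proof (rule bij_betw_imageI)
    \<comment> \<open>Injectivity on a star is inherited from bijectivity on all edges; only
      surjectivity concerns the star.\<close>
    show "inj_on ?g {x \<in> edges D. ini D x = v}"
      using dev_act_Bij(2)[OF h]
      by (auto simp: Bij_def bij_betw_def simp del: development_simps intro: inj_on_subset)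
    show "?g ` {x \<in> edges D. ini D x = v} = {y \<in> edges D. ini D y = ?f v}"
    proof (intro equalityI subsetI)
      fix y assume "y \<in> ?g ` {x \<in> edges D. ini D x = v}"
      then show "y \<in> {y \<in> edges D. ini D y = ?f v}"
        using ini_ter dev_act_closed(2)[OF h] by (auto simp del: development_simps)
    next
      fix y assume "y \<in> {y \<in> edges D. ini D y = ?f v}"
      then have y: "y \<in> edges D" "ini D y = ?f v" by (auto simp del: development_simps)
      obtain p where p: "v = cls p" "p \<in> paths" using v by auto
      \<comment> \<open>Represented over \<open>q \<star> p\<close>, the edge \<open>y\<close> is
        visibly the translate of the edge over the same \<open>a\<close> at
        \<open>p\<close>.\<close>
      then obtain a where a: "y = dev_edge (q \<star> p) a" "a \<in> edges X" "ini X a = xter X p"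
        using star_cases[OF y(1), of "q \<star> p"] y(2) q(2) by (auto simp: f simp del: development_simps)
      have "dev_edge p a \<in> {x \<in> edges D. ini D x = v}"
        using p a dev_edge_closed[of p a] by (simp del: development_simps(2))
      moreover have "y = ?g (dev_edge p a)" using p a by (simp add: g)
      ultimately show "y \<in> ?g ` {x \<in> edges D. ini D x = v}" by blast
    qed
  qed
  show ?thesis
    unfolding scwol_morphism_def
    using ini_ter comp star dev_act_closed[OF h] by (auto simp del: development_simps)
qed

text \<open>Prepending a loop keeps the end vertex in \<open>X\<close> and the edge
  \<open>a\<close>. So a translate of the initial vertex lies over \<open>ini X a\<close>, never
  over \<open>ter X a\<close>; and if that vertex is fixed, so is the edge, being determined by it
  and \<open>a\<close>.\<close>

lemma dev_act_no_inversion: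
  assumes h: "h \<in> carrier pi1" and x: "x \<in> edges D"
  shows "fst (dev_act X C \<sigma>\<^sub>0 h) (ini D x) \<noteq> ter D x"
    and "fst (dev_act X C \<sigma>\<^sub>0 h) (ini D x) = ini D x \<Longrightarrow> snd (dev_act X C \<sigma>\<^sub>0 h) x = x"
proof -
  obtain q where q: "h = hclass X C q" "q \<in> loops"
    using h unfolding carrier_pi1 by blast
  obtain p a where p: "x = dev_edge p a" "p \<in> paths" "a \<in> edges X" "ini X a = xter X p"
    using x by auto
  have "cls (q \<star> p) \<noteq> cls (p \<lhd> a)"
    using xter_eq_if_dev_class_eq[of "q \<star> p" "p \<lhd> a"] no_loops[of a] p q by auto
  then show "fst (dev_act X C \<sigma>\<^sub>0 h) (ini D x) \<noteq> ter D x"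
    using p q by (simp add: dev_act_vertex)
  show "snd (dev_act X C \<sigma>\<^sub>0 h) x = x"
    if "fst (dev_act X C \<sigma>\<^sub>0 h) (ini D x) = ini D x"
    using that p q by (simp add: dev_act_vertex dev_act_edge dev_edge_eq_iff)
qed

end

section \<open>The automorphism group of a scwol\<close>

lemma scwol_morphismD:
  assumes "scwol_morphism X Y f g"
  shows "\<sigma> \<in> vertices X \<Longrightarrow> f \<sigma> \<in> vertices Y" "a \<in> edges X \<Longrightarrow> g a \<in> edges Y"
    "a \<in> edges X \<Longrightarrow> ini Y (g a) = f (ini X a)" "a \<in> edges X \<Longrightarrow> ter Y (g a) = f (ter X a)"
    "(a, b) \<in> edge_pairs X \<Longrightarrow> g (ecomp X a b) = ecomp Y (g a) (g b)"
    "\<sigma> \<in> vertices X \<Longrightarrow>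
      bij_betw g {a \<in> edges X. ini X a = \<sigma>} {a' \<in> edges Y. ini Y a' = f \<sigma>}"
  using assms unfolding scwol_morphism_def by blast+

context scwol
begin

lemma scwol_Aut_carrierD:
  assumes "(f, g) \<in> carrier (scwol_Aut X)"
  shows "f \<in> Bij (vertices X)" "g \<in> Bij (edges X)" "scwol_morphism X X f g"
  using assms by (auto simp: scwol_Aut_def)

lemma scwol_Aut_closed:
  assumes "(f, g) \<in> carrier (scwol_Aut X)" "(f', g') \<in> carrier (scwol_Aut X)"
  shows "(compose (vertices X) f f', compose (edges X) g g') \<in> carrier (scwol_Aut X)"
proof -
  note fg = scwol_Aut_carrierD[OF assms(1)] and fg' = scwol_Aut_carrierD[OF assms(2)]
  note mor = scwol_morphismD[OF fg(3)] and mor' = scwol_morphismD[OF fg'(3)]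
  have "scwol_morphism X X (compose (vertices X) f f') (compose (edges X) g g')"
    unfolding scwol_morphism_def
  proof (intro conjI ballI)
    show "compose (vertices X) f f' \<in> vertices X \<rightarrow> vertices X"
      "compose (edges X) g g' \<in> edges X \<rightarrow> edges X"
      using mor(1,2) mor'(1,2) by (simp_all add: compose_def)
    fix a assume "a \<in> edges X"
    then show "ini X (compose (edges X) g g' a) = compose (vertices X) f f' (ini X a)"
      "ter X (compose (edges X) g g' a) = compose (vertices X) f f' (ter X a)"
      using mor(3,4) mor'(2-4) by (simp_all add: compose_def ini_closed ter_closed)
  next
    fix z assume z: "z \<in> edge_pairs X"
    obtain a b where ab: "z = (a, b)" "(a, b) \<in> edge_pairs X" using z by (cases z) simp
    then have "(g' a, g' b) \<in> edge_pairs X" "a \<in> edges X" "b \<in> edges X"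
      using mor'(2-4) by (auto simp: edge_pairs_def)
    with ab show "case z of (a, b) \<Rightarrow> compose (edges X) g g' (ecomp X a b) =
        ecomp X (compose (edges X) g g' a) (compose (edges X) g g' b)"
      using mor(5) mor'(5) ecomp_closed by (simp add: compose_def)
  next
    fix \<sigma> assume \<sigma>: "\<sigma> \<in> vertices X"
    then have "f' \<sigma> \<in> vertices X" by (rule mor'(1))
    with \<sigma> have "bij_betw (g \<circ> g') {a \<in> edges X. ini X a = \<sigma>} {a \<in> edges X. ini X a = f (f' \<sigma>)}"
      by (intro bij_betw_trans[OF mor'(6) mor(6)])
    \<comment> \<open>A star consists of edges, and there \<open>compose\<close> agrees with
      ordinary composition.\<close>
    then show "bij_betw (compose (edges X) g g') {a \<in> edges X. ini X a = \<sigma>}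
        {a' \<in> edges X. ini X a' = compose (vertices X) f f' \<sigma>}"
      using \<sigma> by (subst bij_betw_cong[of _ _ "g \<circ> g'"]) (auto simp: compose_def)
  qed
  then show ?thesis using fg fg' by (simp add: scwol_Aut_def compose_Bij)
qed

lemma scwol_Aut_inverse:
  assumes "(f, g) \<in> carrier (scwol_Aut X)"
  shows "(restrict (inv_into (vertices X) f) (vertices X),
      restrict (inv_into (edges X) g) (edges X)) \<in> carrier (scwol_Aut X)"
proof -
  note fg = scwol_Aut_carrierD[OF assms]
  note mor = scwol_morphismD[OF fg(3)]
  let ?f = "inv_into (vertices X) f" and ?g = "inv_into (edges X) g"
  have bij: "bij_betw f (vertices X) (vertices X)" "bij_betw g (edges X) (edges X)"
    using fg by (auto simp: Bij_def)
  have f: "?f \<sigma> \<in> vertices X" "f (?f \<sigma>) = \<sigma>" "?f (f \<sigma>) = \<sigma>" if "\<sigma> \<in> vertices X" for \<sigma>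
    using that bij(1) Bij_inv_into_mem[OF fg(1)]
    by (auto simp: bij_betw_inv_into_right bij_betw_inv_into_left)
  have g: "?g a \<in> edges X" "g (?g a) = a" "?g (g a) = a" if "a \<in> edges X" for a
    using that bij(2) Bij_inv_into_mem[OF fg(2)]
    by (auto simp: bij_betw_inv_into_right bij_betw_inv_into_left)
  have ini_ter: "ini X (?g a) = ?f (ini X a)" "ter X (?g a) = ?f (ter X a)"
    if "a \<in> edges X" for a
  proof -
    \<comment> \<open>The morphism \<open>g\<close> is applied to the preimage of \<open>a\<close>;
      then \<open>f\<close> is cancelled by its inverse on vertices.\<close>
    have "ini X a = f (ini X (?g a))" "ter X a = f (ter X (?g a))"
      using that mor(3,4)[of "?g a"] g by simp_all
    then show "ini X (?g a) = ?f (ini X a)" "ter X (?g a) = ?f (ter X a)"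
      using that f(3) g(1) ini_closed ter_closed by simp_all
  qed
  have pairs: "(?g a, ?g b) \<in> edge_pairs X" if "(a, b) \<in> edge_pairs X" for a b
    using that g ini_ter by (simp add: edge_pairs_def)
  have comp: "?g (ecomp X a b) = ecomp X (?g a) (?g b)" if ab: "(a, b) \<in> edge_pairs X" for a b
  proof -
    \<comment> \<open>The claimed identity is checked after applying \<open>g\<close>, which is
      injective on edges.\<close>
    have "g (ecomp X (?g a) (?g b)) = ecomp X (g (?g a)) (g (?g b))"
      using pairs[OF ab] by (rule mor(5))
    also have "\<dots> = ecomp X a b" using ab g by (simp add: edge_pairs_def)
    finally show ?thesis using g(3)[OF ecomp_closed[OF pairs[OF ab]]] by simp
  qed
  have "scwol_morphism X X (restrict ?f (vertices X)) (restrict ?g (edges X))"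
    unfolding scwol_morphism_def
  proof (intro conjI ballI)
    show "restrict ?f (vertices X) \<in> vertices X \<rightarrow> vertices X"
      "restrict ?g (edges X) \<in> edges X \<rightarrow> edges X"
      using f g by auto
    fix a assume a: "a \<in> edges X"
    then show "ini X (restrict ?g (edges X) a) = restrict ?f (vertices X) (ini X a)"
      "ter X (restrict ?g (edges X) a) = restrict ?f (vertices X) (ter X a)"
      using ini_ter by (simp_all add: ini_closed ter_closed)
  next
    fix z assume "z \<in> edge_pairs X"
    then show "case z of (a, b) \<Rightarrow> restrict ?g (edges X) (ecomp X a b) =
        ecomp X (restrict ?g (edges X) a) (restrict ?g (edges X) b)"
      using comp ecomp_closed by (cases z) (auto simp: edge_pairs_def)
  next
    fix \<sigma> assume \<sigma>: "\<sigma> \<in> vertices X"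
    show "bij_betw (restrict ?g (edges X)) {a \<in> edges X. ini X a = \<sigma>}
        {a' \<in> edges X. ini X a' = restrict ?f (vertices X) \<sigma>}"
    \<comment> \<open>On stars the inverse is \<open>g\<close>: it sends the star at
      \<open>?f \<sigma>\<close> to the star at \<open>\<sigma>\<close> because
      \<open>f (?f \<sigma>) = \<sigma>\<close>.\<close>
    proof (rule bij_betw_byWitness[where f' = g])
      show "g ` {a' \<in> edges X. ini X a' = restrict ?f (vertices X) \<sigma>}
          \<subseteq> {a \<in> edges X. ini X a = \<sigma>}"
        using mor(2,3) f \<sigma> by auto
    qed (use g ini_ter \<sigma> mor(2) in auto)
  qed
  then show ?thesis using fg by (simp add: scwol_Aut_def restrict_inv_into_Bij)
qed

text \<open>\<open>scwol_action\<close> demands a homomorphism between groups, so the target has to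
  be a group too; it is used for the development.\<close>

lemma group_scwol_Aut: "group (scwol_Aut X)"
proof (rule groupI)
  fix x y assume "x \<in> carrier (scwol_Aut X)" "y \<in> carrier (scwol_Aut X)"
  then have "(compose (vertices X) (fst x) (fst y), compose (edges X) (snd x) (snd y))
      \<in> carrier (scwol_Aut X)"
    by (intro scwol_Aut_closed) simp_all
  then show "x \<otimes>\<^bsub>scwol_Aut X\<^esub> y \<in> carrier (scwol_Aut X)"
    by (simp add: scwol_Aut_def case_prod_beta)
next
  have "scwol_morphism X X (\<lambda>\<sigma>\<in>vertices X. \<sigma>) (\<lambda>a\<in>edges X. a)"
    unfolding scwol_morphism_def
  proof (intro conjI ballI)
    fix \<sigma> assume "\<sigma> \<in> vertices X"
    then show "bij_betw (\<lambda>a\<in>edges X. a) {a \<in> edges X. ini X a = \<sigma>}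
        {a' \<in> edges X. ini X a' = (\<lambda>\<sigma>\<in>vertices X. \<sigma>) \<sigma>}"
      by (auto simp: bij_betw_def inj_on_def)
  qed (use ecomp_closed in \<open>auto simp: ini_closed ter_closed edge_pairs_def\<close>)
  then show "\<one>\<^bsub>scwol_Aut X\<^esub> \<in> carrier (scwol_Aut X)"
    by (simp add: scwol_Aut_def id_Bij)
next
  fix x y z
  assume "x \<in> carrier (scwol_Aut X)" "y \<in> carrier (scwol_Aut X)" "z \<in> carrier (scwol_Aut X)"
  then show "x \<otimes>\<^bsub>scwol_Aut X\<^esub> y \<otimes>\<^bsub>scwol_Aut X\<^esub> z =
      x \<otimes>\<^bsub>scwol_Aut X\<^esub> (y \<otimes>\<^bsub>scwol_Aut X\<^esub> z)"
    by (auto simp: scwol_Aut_def compose_assoc[symmetric] dest!: Bij_imp_funcset)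
next
  fix x assume x: "x \<in> carrier (scwol_Aut X)"
  then show "\<one>\<^bsub>scwol_Aut X\<^esub> \<otimes>\<^bsub>scwol_Aut X\<^esub> x = x"
    by (auto simp: scwol_Aut_def Id_compose Bij_imp_funcset Bij_imp_extensional)
  let ?y = "(restrict (inv_into (vertices X) (fst x)) (vertices X),
    restrict (inv_into (edges X) (snd x)) (edges X))"
  have "?y \<in> carrier (scwol_Aut X)" using x by (intro scwol_Aut_inverse) simp
  moreover have "fst x \<in> Bij (vertices X)" "snd x \<in> Bij (edges X)"
    using x scwol_Aut_carrierD[of "fst x" "snd x"] by simp_all
  then have "?y \<otimes>\<^bsub>scwol_Aut X\<^esub> x = \<one>\<^bsub>scwol_Aut X\<^esub>"
    by (simp add: scwol_Aut_def Bij_compose_restrict_eq case_prod_beta)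
  ultimately show "\<exists>y\<in>carrier (scwol_Aut X). y \<otimes>\<^bsub>scwol_Aut X\<^esub> x = \<one>\<^bsub>scwol_Aut X\<^esub>"
    by blast
qed

end

section \<open>The homomorphism into the automorphism group\<close>

context pointed_complex_of_groups
begin

lemma scwol_action_development: "scwol_action pi1 D (dev_act X C \<sigma>\<^sub>0)"
proof -
  interpret D: scwol D by (rule scwol_development)
  have "dev_act X C \<sigma>\<^sub>0 \<in> hom pi1 (scwol_Aut D)"
  proof (rule homI)
    fix h assume h: "h \<in> carrier pi1"
    then show "dev_act X C \<sigma>\<^sub>0 h \<in> carrier (scwol_Aut D)"
      using dev_act_Bij[OF h] dev_act_morphism[OF h] by (simp add: scwol_Aut_def case_prod_beta)
  next
    fix h h' assume h: "h \<in> carrier pi1" "h' \<in> carrier pi1"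
    let ?A = "dev_act X C \<sigma>\<^sub>0"
    \<comment> \<open>Both sides are extensional, so agreement on the vertices is enough; likewise
      for the edges below.\<close>
    have "fst (?A (h \<otimes>\<^bsub>pi1\<^esub> h')) = compose (vertices D) (fst (?A h)) (fst (?A h'))"
      by (rule extensionalityI[OF dev_act_extensional(1) compose_extensional])
        (simp add: compose_def dev_act_mult(1)[OF h] del: development_simps)
    moreover have "snd (?A (h \<otimes>\<^bsub>pi1\<^esub> h')) = compose (edges D) (snd (?A h)) (snd (?A h'))"
      by (rule extensionalityI[OF dev_act_extensional(2) compose_extensional])
        (simp add: compose_def dev_act_mult(2)[OF h] del: development_simps)
    ultimately show "?A (h \<otimes>\<^bsub>pi1\<^esub> h') = ?A h \<otimes>\<^bsub>scwol_Aut D\<^esub> ?A h'"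
      by (simp add: scwol_Aut_def case_prod_beta prod_eq_iff del: development_simps)
  qed
  then have "group_hom pi1 (scwol_Aut D) (dev_act X C \<sigma>\<^sub>0)"
    by (intro group_hom.intro group_hom_axioms.intro group_pi1 D.group_scwol_Aut)
  then show ?thesis
    unfolding scwol_action_def using dev_act_no_inversion by (auto simp del: development_simps)
qed

end

theorem mainTheorem4:
  fixes X :: "('v, 'e) scwol_data"
    and C :: "('v, 'e, 'g) cog_data"
    and \<sigma>\<^sub>0 :: 'v
  assumes "complex_of_groups X C"
    and "scwol_connected X"
    and "developable X C"
    and "\<sigma>\<^sub>0 \<in> vertices X"
  shows "is_map (dev_comp_graph X C \<sigma>\<^sub>0)
           (edge_pairs (development X C \<sigma>\<^sub>0)) (edges (development X C \<sigma>\<^sub>0))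
       \<and> scwol (development X C \<sigma>\<^sub>0)
       \<and> scwol_connected (development X C \<sigma>\<^sub>0)
       \<and> is_map (dev_vertex_act_graph X C \<sigma>\<^sub>0)
           (carrier (cog_pi1 X C \<sigma>\<^sub>0) \<times> vertices (development X C \<sigma>\<^sub>0))
           (vertices (development X C \<sigma>\<^sub>0))
       \<and> is_map (dev_edge_act_graph X C \<sigma>\<^sub>0)
           (carrier (cog_pi1 X C \<sigma>\<^sub>0) \<times> edges (development X C \<sigma>\<^sub>0))
           (edges (development X C \<sigma>\<^sub>0))
       \<and> scwol_action (cog_pi1 X C \<sigma>\<^sub>0) (development X C \<sigma>\<^sub>0) (dev_act X C \<sigma>\<^sub>0)"
proof -
  interpret pointed_complex_of_groups X C \<sigma>\<^sub>0
    using assms by (simp add: pointed_complex_of_groups_def pointed_complex_of_groups_axioms_def)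
  show ?thesis
    using is_map_dev_comp scwol_development connected_development is_map_dev_vertex_act
      is_map_dev_edge_act scwol_action_development
    by blast
qed

end
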